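(* For any $p\in\mathbb{N}_0$, $r,m\in\mathbb{N}$ and $\mathbf{k}=(k_1,\dots,k_r)\in\mathbb{N}^r$, $$\sum_{n=1}^\infty\frac{1}{4^n}\binom{2n}{n}\frac{\zeta^\star_n(\mathbf{k})t_n(1_p)}{n^m}\in\mathrm{CMZV}^2_{|\mathbf{k}|+m+p}.$$
   Context: $\zeta^\star_n(\mathbf{k})=\sum_{n\ge n_1\ge\cdots\ge n_r>0}\prod_j n_j^{-k_j}$; $t_n(1_p)=\sum_{n\ge n_1>\cdots>n_p>0}\prod(2n_j-1)^{-1}$ (equal to $1$ if $p=0$); $|\mathbf{k}|=k_1+\cdots+k_r$. $\mathrm{CMZV}^2_w$ is the $\mathbb{Q}$-span of alternating multiple zeta values $\sum_{n_1>\cdots>n_s>0}\prod_j\varepsilon_j^{n_j}n_j^{-s_j}$ ($\varepsilon_j=\pm1$, $(s_1,\varepsilon_1)\ne(1,1)$) of weight $w$. *)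

theory Defs
  imports Complex_Main
begin

definition strict_tuples :: "nat \<Rightarrow> nat \<Rightarrow> nat list set" where
  "strict_tuples N r = {ns. length ns = r \<and> sorted_wrt (>) ns \<and> set ns \<subseteq> {1..N}}"

definition weak_tuples :: "nat \<Rightarrow> nat \<Rightarrow> nat list set" where
  "weak_tuples N r = {ns. length ns = r \<and> sorted_wrt (\<ge>) ns \<and> set ns \<subseteq> {1..N}}"

definition zeta_star :: "nat \<Rightarrow> nat list \<Rightarrow> real" where
  "zeta_star n k = (\<Sum>ns\<in>weak_tuples n (length k). \<Prod>j<length k. 1 / real (ns ! j) ^ (k ! j))"

(* t_ones n p is t_n(1_p): all p exponents are equal to 1. *)
definition t_ones :: "nat \<Rightarrow> nat \<Rightarrow> real" where
  "t_ones n p = (\<Sum>ns\<in>strict_tuples n p. \<Prod>j<p. 1 / (2 * real (ns ! j) - 1))"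

(* An index of an alternating multiple zeta value is the list of the pairs (s_j, eps_j). *)
definition alt_mzv_partial :: "(nat \<times> int) list \<Rightarrow> nat \<Rightarrow> real" where
  "alt_mzv_partial s N = (\<Sum>ns\<in>strict_tuples N (length s).
     \<Prod>j<length s. real_of_int (snd (s ! j)) ^ (ns ! j) / real (ns ! j) ^ fst (s ! j))"

definition admissible :: "(nat \<times> int) list \<Rightarrow> bool" where
  "admissible s \<longleftrightarrow> (\<forall>(a, e)\<in>set s. a \<ge> 1 \<and> e \<in> {1, -1}) \<and> (s \<noteq> [] \<longrightarrow> hd s \<noteq> (1, 1))"

(* The series converges only conditionally if the first pair is (1, -1); as usual it is
   summed by the size of the largest summation variable n_1. *)
definition alt_mzv :: "(nat \<times> int) list \<Rightarrow> real" where
  "alt_mzv s = lim (alt_mzv_partial s)"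

definition alt_mzv_weight :: "(nat \<times> int) list \<Rightarrow> nat" where
  "alt_mzv_weight s = sum_list (map fst s)"

global_interpretation rat_real: vector_space "\<lambda>(q::rat) (x::real). of_rat q * x"
  by unfold_locales (simp_all add: of_rat_add of_rat_mult algebra_simps)

definition CMZV2 :: "nat \<Rightarrow> real set" where
  "CMZV2 w = rat_real.span {alt_mzv s | s. admissible s \<and> alt_mzv_weight s = w}"

end

theory Submission
  imports Defs "HOL-Analysis.Analysis" "HOL-Real_Asymp.Real_Asymp"
begin

text \<open>
  Put \<open>\<Phi>\<^sub>m(q) = \<Sum>n\<ge>1. binom(2n,n)/4^n t\<^sub>n(1\<^sub>p) \<zeta>*\<^sub>n(k) n^(-m) / binom(n+q,n)\<close>;
  the series to be evaluated is \<open>\<Phi>\<^sub>m(0)\<close>, and \<open>\<Phi>\<^sub>m(q) = O(1/q)\<close>. Two recurrences in q hold.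
  First, \<open>\<Phi>\<^sub>m(q) - \<Phi>\<^sub>m(q+1) = \<Phi>\<^sub>m\<^sub>-\<^sub>1(q+1)/(q+1)\<close>. Second, a telescoping identity in n expresses
  \<open>\<Phi>\<^sub>0(q+1)\<close>, for k = (a, k'), through the values at q of the functions for k' and m = a, multiplied by
  \<open>(q+1)/(2q+1)^(j+1)\<close>. By Abel summation, these recurrences reduce
  \<open>\<Sum>q. F(2q+1) (\<Phi>(q) - \<Phi>(q+1))\<close>, for a truncated alternating multiple sum F, to sums of the same kind
  with smaller m or shorter k, where F has absorbed the denominators. In the end there remains a truncated
  alternating sum f(2N) of the right weight that converges. Its limit lies in \<open>CMZV2\<close>: f agrees, up to
  an error smaller than every power of 1/log N, with a polynomial in the harmonic number whose constant
  coefficient lies in \<open>CMZV2\<close>, and this polynomial is constant since f(2N) converges.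
  For F = 1 the sum is \<open>\<Phi>(0)\<close>.
\<close>

section \<open>Recursion on the largest summation variable\<close>

lemma sum_strict_tuples_Suc:
  "(\<Sum>ns\<in>strict_tuples N (Suc r). g ns) = (\<Sum>n=1..N. \<Sum>ms\<in>strict_tuples (n - 1) r. g (n # ms))"
proof -
  have eq: "strict_tuples N (Suc r) = (\<lambda>(n, ms). n # ms) ` (SIGMA n:{1..N}. strict_tuples (n - 1) r)"
  proof (intro set_eqI iffI)
    fix ns assume "ns \<in> strict_tuples N (Suc r)"
    then obtain n ms where "ns = n # ms" "length ms = r" "sorted_wrt (>) ms" "\<forall>x\<in>set ms. n > x"
      "n \<in> {1..N}" "set ms \<subseteq> {1..N}"
      by (cases ns) (auto simp: strict_tuples_def)
    moreover from this have "set ms \<subseteq> {1..n - 1}" by fastforce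
    ultimately show "ns \<in> (\<lambda>(n, ms). n # ms) ` (SIGMA n:{1..N}. strict_tuples (n - 1) r)"
      by (force simp: strict_tuples_def image_iff)
  next
    fix ns assume "ns \<in> (\<lambda>(n, ms). n # ms) ` (SIGMA n:{1..N}. strict_tuples (n - 1) r)"
    then show "ns \<in> strict_tuples N (Suc r)"
      by (fastforce simp: strict_tuples_def)
  qed
  have fin: "finite (strict_tuples M r)" for M
    by (rule finite_subset[OF _ finite_lists_length_eq[of "{1..M}" r]]) (auto simp: strict_tuples_def)
  show ?thesis
    unfolding eq by (subst sum.reindex) (auto simp: inj_on_def sum.Sigma fin case_prod_beta')
qed

lemma sum_weak_tuples_Suc:
  "(\<Sum>ns\<in>weak_tuples N (Suc r). g ns) = (\<Sum>n=1..N. \<Sum>ms\<in>weak_tuples n r. g (n # ms))"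
proof -
  have eq: "weak_tuples N (Suc r) = (\<lambda>(n, ms). n # ms) ` (SIGMA n:{1..N}. weak_tuples n r)"
  proof (intro set_eqI iffI)
    fix ns assume "ns \<in> weak_tuples N (Suc r)"
    then obtain n ms where "ns = n # ms" "length ms = r" "sorted_wrt (\<ge>) ms" "\<forall>x\<in>set ms. n \<ge> x"
      "n \<in> {1..N}" "set ms \<subseteq> {1..N}"
      by (cases ns) (auto simp: weak_tuples_def)
    moreover from this have "set ms \<subseteq> {1..n}" by fastforce
    ultimately show "ns \<in> (\<lambda>(n, ms). n # ms) ` (SIGMA n:{1..N}. weak_tuples n r)"
      by (force simp: weak_tuples_def image_iff)
  next
    fix ns assume "ns \<in> (\<lambda>(n, ms). n # ms) ` (SIGMA n:{1..N}. weak_tuples n r)"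
    then show "ns \<in> weak_tuples N (Suc r)"
      by (fastforce simp: weak_tuples_def)
  qed
  have fin: "finite (weak_tuples M r)" for M
    by (rule finite_subset[OF _ finite_lists_length_eq[of "{1..M}" r]]) (auto simp: weak_tuples_def)
  show ?thesis
    unfolding eq by (subst sum.reindex) (auto simp: inj_on_def sum.Sigma fin case_prod_beta')
qed

lemma strict_tuples_0: "strict_tuples N 0 = {[]}"
  by (auto simp: strict_tuples_def)

lemma weak_tuples_0: "weak_tuples N 0 = {[]}"
  by (auto simp: weak_tuples_def)

lemma zeta_star_Nil: "zeta_star n [] = 1"
  by (simp add: zeta_star_def weak_tuples_0)

lemma zeta_star_Cons: "zeta_star n (a # k) = (\<Sum>j=1..n. zeta_star j k / real j ^ a)"
  by (simp add: zeta_star_def sum_weak_tuples_Suc prod.lessThan_Suc_shift sum_divide_distrib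
      del: prod.lessThan_Suc)

lemma t_ones_0: "t_ones n 0 = 1"
  by (simp add: t_ones_def strict_tuples_0)

lemma t_ones_Suc: "t_ones n (Suc p) = (\<Sum>j=1..n. t_ones (j - 1) p / (2 * real j - 1))"
  by (simp add: t_ones_def sum_strict_tuples_Suc prod.lessThan_Suc_shift sum_divide_distrib
      del: prod.lessThan_Suc)

section \<open>Truncated alternating sums and their rational span\<close>

text \<open>Evaluating \<open>f\<close> at \<open>n - 1\<close> encodes the strict inequality
  between successive variables; \<open>star_sum\<close> is the weak counterpart.\<close>

definition nested_sum :: "nat \<Rightarrow> int \<Rightarrow> (nat \<Rightarrow> real) \<Rightarrow> nat \<Rightarrow> real" where
  "nested_sum a e f N = (\<Sum>n=1..N. of_int e ^ n / real n ^ a * f (n - 1))"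

lemma nested_sum_0 [simp]: "nested_sum a e f 0 = 0"
  by (simp add: nested_sum_def)

lemma nested_sum_Suc:
  "nested_sum a e f (Suc N) = nested_sum a e f N + of_int e ^ Suc N / real (Suc N) ^ a * f N"
  by (simp add: nested_sum_def)

fun alt_sum :: "(nat \<times> int) list \<Rightarrow> nat \<Rightarrow> real" where
  "alt_sum [] = (\<lambda>_. 1)"
| "alt_sum ((a, e) # s) = nested_sum a e (alt_sum s)"

lemma alt_mzv_partial_eq: "alt_mzv_partial s N = alt_sum s N"
proof (induction s arbitrary: N)
  case Nil
  show ?case by (simp add: alt_mzv_partial_def strict_tuples_0)
next
  case (Cons x s)
  obtain a e where x: "x = (a, e)" by (cases x)
  show ?case unfolding x
    by (simp add: alt_mzv_partial_def sum_strict_tuples_Suc prod.lessThan_Suc_shift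
        nested_sum_def Cons.IH[symmetric] sum_distrib_left del: prod.lessThan_Suc)
qed

text \<open>Unlike \<open>admissible\<close>, this allows a leading pair (1, 1): truncations of
  divergent series occur along the way and have to be regularised.\<close>

definition alt_index :: "(nat \<times> int) list \<Rightarrow> bool" where
  "alt_index s \<longleftrightarrow> (\<forall>(a, e)\<in>set s. a \<ge> 1 \<and> e \<in> {1, -1})"

lemma alt_index_Nil [simp]: "alt_index []"
  by (simp add: alt_index_def)

lemma alt_index_Cons [simp]: "alt_index ((a, e) # s) \<longleftrightarrow> a \<ge> 1 \<and> e \<in> {1, -1} \<and> alt_index s"
  by (auto simp: alt_index_def)

lemma alt_mzv_weight_Nil [simp]: "alt_mzv_weight [] = 0"
  by (simp add: alt_mzv_weight_def)

lemma alt_mzv_weight_Cons [simp]: "alt_mzv_weight ((a, e) # s) = a + alt_mzv_weight s"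
  by (simp add: alt_mzv_weight_def)

definition leading_ones :: "(nat \<times> int) list \<Rightarrow> nat" where
  "leading_ones s = length (takeWhile ((=) (1, 1)) s)"

lemma leading_ones_Nil [simp]: "leading_ones [] = 0"
  by (simp add: leading_ones_def)

lemma leading_ones_Cons [simp]:
  "leading_ones ((a, e) # s) = (if a = 1 \<and> e = 1 then Suc (leading_ones s) else 0)"
  by (auto simp: leading_ones_def)

lemma admissible_iff: "admissible s \<longleftrightarrow> alt_index s \<and> leading_ones s = 0"
  by (cases s) (auto simp: admissible_def alt_index_def leading_ones_def)

text \<open>The second index bounds the number of leading pairs (1, 1), which is the order of the logarithmic divergence.\<close>

inductive alt_span :: "nat \<Rightarrow> nat \<Rightarrow> (nat \<Rightarrow> real) \<Rightarrow> bool" for w i where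
  zero: "alt_span w i (\<lambda>_. 0)"
| step: "\<lbrakk>alt_index s; alt_mzv_weight s = w; leading_ones s \<le> i; alt_span w i f\<rbrakk>
    \<Longrightarrow> alt_span w i (\<lambda>N. of_rat q * alt_sum s N + f N)"

lemma alt_span_add: "alt_span w i f \<Longrightarrow> alt_span w i g \<Longrightarrow> alt_span w i (\<lambda>N. f N + g N)"
proof (induction rule: alt_span.induct)
  case (step s f q)
  then show ?case using alt_span.step[of s w i "\<lambda>N. f N + g N" q] by (simp add: add.assoc)
qed simp

lemma alt_span_scale: "alt_span w i f \<Longrightarrow> alt_span w i (\<lambda>N. of_rat c * f N)"
proof (induction rule: alt_span.induct)
  case (step s f q)
  have eq: "(\<lambda>N. of_rat c * (of_rat q * alt_sum s N + f N))
      = (\<lambda>N. of_rat (c * q) * alt_sum s N + of_rat c * f N)"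
    by (simp add: distrib_left)
  show ?case unfolding eq by (rule alt_span.step) (use step in auto)
qed (simp add: alt_span.zero)

lemma alt_span_uminus: "alt_span w i f \<Longrightarrow> alt_span w i (\<lambda>N. - f N)"
  using alt_span_scale[of w i f "-1"] by simp

lemma alt_span_diff: "alt_span w i f \<Longrightarrow> alt_span w i g \<Longrightarrow> alt_span w i (\<lambda>N. f N - g N)"
  using alt_span_add[OF _ alt_span_uminus, of w i f g] by simp

lemma alt_span_alt_sum:
  "alt_index s \<Longrightarrow> alt_mzv_weight s = w \<Longrightarrow> leading_ones s \<le> i \<Longrightarrow> alt_span w i (alt_sum s)"
  using alt_span.step[OF _ _ _ alt_span.zero, of s w i 1] by simp

lemma alt_span_mono: "alt_span w i f \<Longrightarrow> i \<le> j \<Longrightarrow> alt_span w j f"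
  proof (induction rule: alt_span.induct)
  case (step s f q)
  then show ?case by (intro alt_span.step[of s w j f q]) auto
qed (rule alt_span.zero)

lemma nested_sum_lincomb:
  "nested_sum a e (\<lambda>N. c * f N + g N) N = c * nested_sum a e f N + nested_sum a e g N"
  by (simp add: nested_sum_def sum.distrib sum_distrib_left algebra_simps)

lemma alt_span_nested_sum:
  assumes "alt_span w i f" "a \<ge> 1" "e \<in> {1, -1}"
  shows "alt_span (a + w) (if a = 1 \<and> e = 1 then Suc i else 0) (nested_sum a e f)"
  using assms(1)
proof (induction rule: alt_span.induct)
  case zero
  have "nested_sum a e (\<lambda>_. 0) = (\<lambda>_. 0)" by (simp add: nested_sum_def fun_eq_iff)
  then show ?case by (simp add: alt_span.zero)
next
  case (step s f q)
  have eq: "nested_sum a e (\<lambda>N. of_rat q * alt_sum s N + f N)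
      = (\<lambda>N. of_rat q * alt_sum ((a, e) # s) N + nested_sum a e f N)"
    by (simp add: nested_sum_lincomb fun_eq_iff)
  show ?case
    unfolding eq by (rule alt_span.step) (use step assms in auto)
qed

section \<open>Products with the harmonic number\<close>

lemma alt_sum_11: "alt_sum [(1, 1)] = harm"
  by (simp add: nested_sum_def harm_def fun_eq_iff divide_inverse)

text \<open>Quasi-shuffle product: the harmonic variable equals, exceeds or is smaller than the
  outermost variable of the other sum, which gives the three terms in this order.\<close>

lemma harm_times_alt_sum_Cons:
  "harm N * alt_sum ((a, e) # s) N = alt_sum ((Suc a, e) # s) N
     + alt_sum ((1, 1) # (a, e) # s) N + nested_sum a e (\<lambda>n. harm n * alt_sum s n) N"
proof (induction N)
  case (Suc N)
  have 1: "alt_sum ((a, e) # s) (Suc N)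
      = alt_sum ((a, e) # s) N + of_int e ^ Suc N / real (Suc N) ^ a * alt_sum s N"
    by (simp add: nested_sum_Suc)
  have 2: "alt_sum ((1, 1) # (a, e) # s) (Suc N)
      = alt_sum ((1, 1) # (a, e) # s) N + alt_sum ((a, e) # s) N / real (Suc N)"
    by (simp add: nested_sum_Suc)
  have 3: "alt_sum ((Suc a, e) # s) (Suc N)
      = alt_sum ((Suc a, e) # s) N + of_int e ^ Suc N / real (Suc N) ^ a * alt_sum s N / real (Suc N)"
    by (simp add: nested_sum_Suc)
  have 4: "harm (Suc N) = harm N + 1 / real (Suc N)"
    by (simp add: harm_Suc divide_inverse)
  show ?case unfolding 1 2 3 4 nested_sum_Suc using Suc
    by (simp only: ring_distribs add_divide_distrib) (simp add: algebra_simps)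
qed simp

text \<open>A harmonic variable can join an initial run of i pairs (1, 1) in i + 1 positions, each
  time giving the index \<open>(1, 1) # s\<close>; every other term has at most i leading pairs. So
  \<open>alt_sum ((1, 1) # s)\<close> can be solved for in terms of less divergent sums.\<close>

lemma harm_times_alt_sum:
  assumes "alt_index s"
  shows "alt_span (Suc (alt_mzv_weight s)) (leading_ones s)
    (\<lambda>N. harm N * alt_sum s N - of_nat (Suc (leading_ones s)) * alt_sum ((1, 1) # s) N)"
  using assms
proof (induction s)
  case Nil
  show ?case by (simp add: alt_sum_11[simplified] alt_span.zero)
next
  case (Cons x s)
  obtain a e where x: "x = (a, e)" by (cases x)
  define w where "w = alt_mzv_weight s"
  define i where "i = leading_ones s"
  define v where "v = (\<lambda>N. harm N * alt_sum s N - of_nat (Suc i) * alt_sum ((1, 1) # s) N)"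
  from Cons.prems have ae: "a \<ge> 1" "e \<in> {1, -1}" and s: "alt_index s" by (auto simp: x)
  have v: "alt_span (Suc w) i v" using Cons.IH[OF s] by (simp add: v_def w_def i_def)
  have hs: "(\<lambda>n. harm n * alt_sum s n)
      = (\<lambda>N. of_rat (of_nat (Suc i)) * alt_sum ((1, 1) # s) N + v N)"
    by (simp add: v_def fun_eq_iff del: of_nat_Suc)
  have nest: "nested_sum a e (\<lambda>n. harm n * alt_sum s n)
      = (\<lambda>N. of_nat (Suc i) * alt_sum ((a, e) # (1, 1) # s) N + nested_sum a e v N)"
    unfolding hs nested_sum_lincomb fun_eq_iff by (simp del: of_nat_Suc)
  have extra: "alt_span (Suc (a + w)) 0 (alt_sum ((Suc a, e) # s))"
    using ae s by (intro alt_span_alt_sum) (auto simp: w_def)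
  show ?case
  proof (cases "a = 1 \<and> e = 1")
    \<comment> \<open>The i + 1 insertions further inside and the middle term of the product add up
      to the coefficient i + 2.\<close>
    case True
    have lead: "leading_ones (x # s) = Suc i" and wt: "alt_mzv_weight (x # s) = a + w"
      using True by (simp_all add: x i_def w_def)
    have "alt_span (a + Suc w) (Suc i) (nested_sum a e v)"
      using alt_span_nested_sum[OF v ae] True by simp
    then have "alt_span (Suc (a + w)) (Suc i) (\<lambda>N. alt_sum ((Suc a, e) # s) N + nested_sum a e v N)"
      by (intro alt_span_add alt_span_mono[OF extra]) auto
    also have "(\<lambda>N. alt_sum ((Suc a, e) # s) N + nested_sum a e v N) = (\<lambda>N. harm N * alt_sum (x # s) N
        - of_nat (Suc (leading_ones (x # s))) * alt_sum ((1, 1) # x # s) N)"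
      unfolding x harm_times_alt_sum_Cons nest fun_eq_iff
      using True by (simp add: i_def algebra_simps)
    finally show ?thesis using lead wt by (simp only:)
  next
    \<comment> \<open>Without an initial run the coefficient is 1 and cancels the middle term of the
      product; the two other terms start with a pair different from (1, 1).\<close>
    case False
    have lead: "leading_ones (x # s) = 0" and wt: "alt_mzv_weight (x # s) = a + w"
      using False by (auto simp: x w_def)
    have "alt_span (a + Suc w) 0 (nested_sum a e (\<lambda>n. harm n * alt_sum s n))"
    proof -
      have "alt_span (Suc w) (Suc i) (\<lambda>n. harm n * alt_sum s n)"
        unfolding hs
        by (rule alt_span.step) (use s v in \<open>auto simp: w_def i_def intro: alt_span_mono\<close>)
      from alt_span_nested_sum[OF this ae] False show ?thesis by auto
    qed
    then have "alt_span (Suc (a + w)) 0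
        (\<lambda>N. alt_sum ((Suc a, e) # s) N + nested_sum a e (\<lambda>n. harm n * alt_sum s n) N)"
      by (intro alt_span_add extra) auto
    also have "(\<lambda>N. alt_sum ((Suc a, e) # s) N + nested_sum a e (\<lambda>n. harm n * alt_sum s n) N)
      = (\<lambda>N. harm N * alt_sum (x # s) N
        - of_nat (Suc (leading_ones (x # s))) * alt_sum ((1, 1) # x # s) N)"
      unfolding x harm_times_alt_sum_Cons fun_eq_iff
      using False by auto
    finally show ?thesis using lead wt by (simp only:)
  qed
qed

section \<open>Polylogarithmic growth\<close>

text \<open>The harmonic number replaces log n, so that the bound makes sense at n = 0; since 1 +
  \<open>harm n\<close> is at least 1, the exponent \<open>r\<close> may be enlarged freely.\<close>

definition polylog :: "(nat \<Rightarrow> real) \<Rightarrow> bool" where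
  "polylog f \<longleftrightarrow> (\<exists>C r. \<forall>n. \<bar>f n\<bar> \<le> C * (1 + harm n) ^ r)"

lemma polylog_const: "polylog (\<lambda>_. c)"
  unfolding polylog_def by (intro exI[of _ "\<bar>c\<bar>"] exI[of _ 0]) simp

lemma polylog_mono:
  assumes "polylog g" "\<And>n. \<bar>f n\<bar> \<le> \<bar>g n\<bar>"
  shows "polylog f"
  using assms unfolding polylog_def by (meson order_trans)

lemma polylog_mult:
  assumes "polylog f" "polylog g"
  shows "polylog (\<lambda>n. f n * g n)"
proof -
  obtain C r D s where "\<And>n. \<bar>f n\<bar> \<le> C * (1 + harm n) ^ r" "\<And>n. \<bar>g n\<bar> \<le> D * (1 + harm n) ^ s"
    using assms unfolding polylog_def by metis
  then have "\<bar>f n * g n\<bar> \<le> (C * (1 + harm n) ^ r) * (D * (1 + harm n) ^ s)" for n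
    unfolding abs_mult by (intro mult_mono') auto
  then have "\<bar>f n * g n\<bar> \<le> (C * D) * (1 + harm n) ^ (r + s)" for n
    by (simp add: power_add mult_ac)
  then show ?thesis unfolding polylog_def by blast
qed

lemma polylog_add:
  assumes "polylog f" "polylog g"
  shows "polylog (\<lambda>n. f n + g n)"
proof -
  obtain C r D s where f: "\<And>n. \<bar>f n\<bar> \<le> C * (1 + harm n) ^ r" and g: "\<And>n. \<bar>g n\<bar> \<le> D * (1 + harm n) ^ s"
    using assms unfolding polylog_def by metis
  have CD: "C \<ge> 0" "D \<ge> 0" using f[of 0] g[of 0] by (auto simp: harm_expand)
  have "\<bar>f n + g n\<bar> \<le> (C + D) * (1 + harm n) ^ (r + s)" for n
  proof -
    have "(1 + harm n :: real) ^ r \<le> (1 + harm n) ^ (r + s)" "(1 + harm n :: real) ^ s \<le> (1 + harm n) ^ (r + s)"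
      by (auto intro!: power_increasing simp: harm_nonneg)
    then have "C * (1 + harm n) ^ r \<le> C * (1 + harm n) ^ (r + s)"
      "D * (1 + harm n) ^ s \<le> D * (1 + harm n) ^ (r + s)"
      using CD by (auto intro: mult_left_mono)
    then show ?thesis using f[of n] g[of n] by (simp add: distrib_right)
  qed
  then show ?thesis unfolding polylog_def by blast
qed

text \<open>Summation against 1/j costs one more factor 1 + \<open>harm n\<close>.\<close>

lemma polylog_sum:
  assumes "polylog g" "\<And>n j. 1 \<le> j \<Longrightarrow> j \<le> n \<Longrightarrow> \<bar>h j\<bar> \<le> \<bar>g j\<bar> / real j"
  shows "polylog (\<lambda>n. \<Sum>j=1..n. h j)"
proof -
  obtain C r where g: "\<And>n. \<bar>g n\<bar> \<le> C * (1 + harm n) ^ r"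
    using assms unfolding polylog_def by metis
  have C: "C \<ge> 0" using g[of 0] by (simp add: harm_expand)
  have "\<bar>\<Sum>j=1..n. h j\<bar> \<le> C * (1 + harm n) ^ Suc r" for n
  proof -
    have "\<bar>\<Sum>j=1..n. h j\<bar> \<le> (\<Sum>j=1..n. \<bar>h j\<bar>)" by (rule sum_abs)
    also have "\<dots> \<le> (\<Sum>j=1..n. C * (1 + harm n) ^ r * inverse (real j))"
    proof (rule sum_mono)
      fix j assume j: "j \<in> {1..n}"
      have "\<bar>g j\<bar> \<le> C * (1 + harm j) ^ r" by (rule g)
      also have "\<dots> \<le> C * (1 + harm n) ^ r"
        using j C by (intro mult_left_mono power_mono) (auto simp: harm_mono harm_nonneg)
      finally have "\<bar>g j\<bar> / real j \<le> C * (1 + harm n) ^ r / real j" by (rule divide_right_mono) simp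
      moreover have "\<bar>h j\<bar> \<le> \<bar>g j\<bar> / real j" using assms(2)[of j n] j by simp
      ultimately show "\<bar>h j\<bar> \<le> C * (1 + harm n) ^ r * inverse (real j)"
        by (simp add: divide_inverse[symmetric])
    qed
    also have "\<dots> = C * (1 + harm n) ^ r * harm n"
      by (simp add: sum_distrib_left harm_def)
    also have "\<dots> \<le> C * (1 + harm n) ^ r * (1 + harm n)"
      using C by (intro mult_left_mono) (auto simp: harm_nonneg)
    finally show ?thesis by (simp add: mult_ac)
  qed
  then show ?thesis unfolding polylog_def by blast
qed

lemma polylog_pred: "polylog f \<Longrightarrow> polylog (\<lambda>n. f (n - 1))"
proof -
  assume "polylog f"
  then obtain C r where f: "\<And>n. \<bar>f n\<bar> \<le> C * (1 + harm n) ^ r" unfolding polylog_def by metis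
  have C: "C \<ge> 0" using f[of 0] by (simp add: harm_expand)
  have "\<bar>f (n - 1)\<bar> \<le> C * (1 + harm n) ^ r" for n
    by (rule order_trans[OF f], intro mult_left_mono power_mono) (auto simp: harm_mono harm_nonneg C)
  then show ?thesis unfolding polylog_def by blast
qed

lemma harm_le_1_plus_ln: "n \<ge> 1 \<Longrightarrow> harm n \<le> 1 + ln (real n)"
  using decseqD[OF decseq_harm_diff_ln, of 0 "n - 1"] by (simp add: harm_expand)

lemma polylog_powr_bound:
  assumes "polylog f" "\<delta> > 0"
  obtains C where "C \<ge> 0" "\<And>n. \<bar>f n\<bar> \<le> C * real (Suc n) powr \<delta>"
proof -
  obtain C r where f: "\<And>n. \<bar>f n\<bar> \<le> C * (1 + harm n) ^ r"
    using assms unfolding polylog_def by metis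
  have C: "C \<ge> 0" using f[of 0] by (simp add: harm_expand)
  have "(\<lambda>n. (2 + ln (real (Suc n))) ^ r / real (Suc n) powr \<delta>) \<longlonglongrightarrow> 0"
    using assms(2) by real_asymp
  then have "Bseq (\<lambda>n. (2 + ln (real (Suc n))) ^ r / real (Suc n) powr \<delta>)"
    using convergentI convergent_imp_Bseq by blast
  then obtain K where K: "K > 0" "\<And>n. \<bar>(2 + ln (real (Suc n))) ^ r / real (Suc n) powr \<delta>\<bar> \<le> K"
    unfolding Bseq_def by auto
  have "\<bar>f n\<bar> \<le> (C * K) * real (Suc n) powr \<delta>" for n
  proof -
    have "(1 + harm n :: real) \<le> 1 + harm (Suc n)" by (simp add: harm_mono)
    also have "\<dots> \<le> 2 + ln (real (Suc n))" using harm_le_1_plus_ln[of "Suc n"] by simp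
    finally have "(1 + harm n :: real) ^ r \<le> (2 + ln (real (Suc n))) ^ r"
      by (intro power_mono) (auto simp: harm_nonneg)
    also have "\<dots> \<le> K * real (Suc n) powr \<delta>"
      using K(2)[of n] by (simp add: divide_le_eq)
    finally have "C * (1 + harm n) ^ r \<le> C * (K * real (Suc n) powr \<delta>)"
      using C by (intro mult_left_mono)
    with f[of n] show ?thesis by (simp add: mult_ac)
  qed
  with C K(1) that[of "C * K"] show ?thesis by simp
qed

lemma polylog_powr_null:
  assumes "polylog f" "\<delta> > 0"
  shows "(\<lambda>n. f n * real (Suc n) powr (- \<delta>)) \<longlonglongrightarrow> 0"
proof -
  obtain C where C: "C \<ge> 0" "\<And>n. \<bar>f n\<bar> \<le> C * real (Suc n) powr (\<delta> / 2)"
    using polylog_powr_bound[OF assms(1), of "\<delta> / 2"] assms(2) by auto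
  have lim: "(\<lambda>n. C * real (Suc n) powr (- \<delta> / 2)) \<longlonglongrightarrow> 0"
    using assms(2) by real_asymp
  have "norm (f n * real (Suc n) powr (- \<delta>)) \<le> C * real (Suc n) powr (- \<delta> / 2)" for n
  proof -
    have "\<bar>f n\<bar> * real (Suc n) powr (- \<delta>) \<le> C * real (Suc n) powr (\<delta> / 2) * real (Suc n) powr (- \<delta>)"
      by (intro mult_right_mono C) simp
    also have "\<dots> = C * real (Suc n) powr (- \<delta> / 2)"
      by (simp add: mult.assoc flip: powr_add)
    finally show ?thesis by (simp add: abs_mult)
  qed
  then show ?thesis by (intro Lim_null_comparison[OF always_eventually lim] allI)
qed

lemma polylog_harm_power: "polylog (\<lambda>n. harm n ^ j)"
proof -
  have "\<bar>harm n ^ j\<bar> \<le> 1 * (1 + harm n :: real) ^ j" for n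
    by (simp add: power_abs harm_nonneg) (intro power_mono, auto simp: harm_nonneg)
  then show ?thesis unfolding polylog_def by blast
qed

lemma polylog_alt_sum: "alt_index s \<Longrightarrow> polylog (alt_sum s)"
proof (induction s)
  case (Cons x s)
  obtain a e where x: "x = (a, e)" by (cases x)
  from Cons.prems have ae: "a \<ge> 1" "e \<in> {1, -1}" and s: "alt_index s" by (auto simp: x)
  have "polylog (\<lambda>n. \<Sum>j=1..n. of_int e ^ j / real j ^ a * alt_sum s (j - 1))"
  proof (rule polylog_sum[OF polylog_pred[OF Cons.IH[OF s]]])
    fix n j :: nat assume j: "1 \<le> j"
    have "real j ^ 1 \<le> real j ^ a" using j ae by (intro power_increasing) auto
    then have "\<bar>of_int e ^ j / real j ^ a\<bar> \<le> 1 / real j"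
      using ae j by (auto simp: power_abs frac_le)
    then show "\<bar>of_int e ^ j / real j ^ a * alt_sum s (j - 1)\<bar> \<le> \<bar>alt_sum s (j - 1)\<bar> / real j"
      unfolding abs_mult using mult_right_mono[OF _ abs_ge_zero] by fastforce
  qed
  then show ?case by (simp add: x nested_sum_def[abs_def])
qed (simp add: polylog_const)

lemma polylog_alt_span: "alt_span w i f \<Longrightarrow> polylog f"
proof (induction rule: alt_span.induct)
  case (step s f q)
  then show ?case
    by (intro polylog_add polylog_mult polylog_const polylog_alt_sum)
qed (rule polylog_const)

text \<open>The increment is the inner sum times a factor of size at most 1/(n + 1). This controls
  how much the coefficients of an alternating series change from one term to the next.\<close>

lemma polylog_alt_sum_increment:
  assumes "alt_index s"
  shows "polylog (\<lambda>n. real (Suc n) * (alt_sum s (Suc n) - alt_sum s n))"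
proof (cases s)
  case Nil
  then show ?thesis by (simp add: polylog_const)
next
  case (Cons x s')
  obtain a e where x: "x = (a, e)" by (cases x)
  from assms have ae: "a \<ge> 1" "e \<in> {1, -1}" and s': "alt_index s'" by (auto simp: x Cons)
  show ?thesis
  proof (rule polylog_mono[OF polylog_alt_sum[OF s']])
    fix n
    have "real (Suc n) ^ 1 \<le> real (Suc n) ^ a" using ae by (intro power_increasing) auto
    then have "\<bar>real (Suc n) * (of_int e ^ Suc n / real (Suc n) ^ a)\<bar> \<le> 1"
      using ae by (auto simp: abs_mult power_abs divide_le_eq)
    then have "\<bar>real (Suc n) * (of_int e ^ Suc n / real (Suc n) ^ a)\<bar> * \<bar>alt_sum s' n\<bar> \<le> 1 * \<bar>alt_sum s' n\<bar>"
      by (rule mult_right_mono) simp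
    then show "\<bar>real (Suc n) * (alt_sum s (Suc n) - alt_sum s n)\<bar> \<le> \<bar>alt_sum s' n\<bar>"
      by (simp add: Cons x nested_sum_Suc abs_mult mult_ac del: of_nat_Suc power_Suc)
  qed
qed

section \<open>Errors smaller than every power of 1/log\<close>

text \<open>Plain convergence to 0 would not survive multiplication by the harmonic number, which
  the regularisation in \<open>has_expansion_alt_sum\<close> performs repeatedly.\<close>

definition log_small :: "(nat \<Rightarrow> real) \<Rightarrow> bool" where
  "log_small f \<longleftrightarrow> (\<forall>j. (\<lambda>n. harm n ^ j * f n) \<longlonglongrightarrow> 0)"

lemma log_small_tendsto: "log_small f \<Longrightarrow> f \<longlonglongrightarrow> 0"
  unfolding log_small_def by (drule spec[of _ 0]) simp

lemma log_small_0: "log_small (\<lambda>_. 0)"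
  by (simp add: log_small_def)

lemma log_small_add: "log_small f \<Longrightarrow> log_small g \<Longrightarrow> log_small (\<lambda>n. f n + g n)"
  unfolding log_small_def distrib_left by (intro allI tendsto_add_zero) auto

lemma log_small_cmult: "log_small f \<Longrightarrow> log_small (\<lambda>n. c * f n)"
  unfolding log_small_def mult.left_commute[of _ c] by (intro allI tendsto_mult_right_zero) auto

lemma log_small_harm: "log_small f \<Longrightarrow> log_small (\<lambda>n. harm n * f n)"
  unfolding log_small_def
proof
  fix j assume "\<forall>j. (\<lambda>n. harm n ^ j * f n) \<longlonglongrightarrow> 0"
  then have "(\<lambda>n. harm n ^ Suc j * f n) \<longlonglongrightarrow> 0" by blast
  then show "(\<lambda>n. harm n ^ j * (harm n * f n)) \<longlonglongrightarrow> 0" by (simp add: mult_ac)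
qed

lemma log_small_powr:
  assumes "polylog g" "\<delta> > 0" "\<And>n. \<bar>f n\<bar> \<le> \<bar>g n\<bar> * real (Suc n) powr (-\<delta>)"
  shows "log_small f"
  unfolding log_small_def
proof
  fix j
  have pl: "polylog (\<lambda>n. harm n ^ j * \<bar>g n\<bar>)"
    by (intro polylog_mult polylog_harm_power polylog_mono[OF assms(1)]) auto
  have "norm (harm n ^ j * f n) \<le> (harm n ^ j * \<bar>g n\<bar>) * real (Suc n) powr (- \<delta>)" for n
  proof -
    have "harm n ^ j * \<bar>f n\<bar> \<le> harm n ^ j * (\<bar>g n\<bar> * real (Suc n) powr (- \<delta>))"
      by (intro mult_left_mono assms) (simp add: harm_nonneg)
    then show ?thesis by (simp add: abs_mult power_abs mult_ac)
  qed
  then show "(\<lambda>n. harm n ^ j * f n) \<longlonglongrightarrow> 0"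
    by (intro Lim_null_comparison[OF always_eventually polylog_powr_null[OF pl assms(2)]] allI)
qed

text \<open>With a = sqrt(n + 1) and b = sqrt(n + 2) the difference 1/a - 1/b equals 1/(a b (a +
  b)). The constant 4 comes from a b (a + b) <= 4 a^3, a consequence of b <= 2 a.\<close>

lemma powr_telescope:
  "real (Suc n) powr (- 3 / 2) \<le> 4 * (real (Suc n) powr (- 1 / 2) - real (Suc (Suc n)) powr (- 1 / 2))"
proof -
  define a b where "a = sqrt (real (Suc n))" and "b = sqrt (real (Suc (Suc n)))"
  have ab: "a > 0" "b > 0" "b ^ 2 = a ^ 2 + 1" "a ^ 2 \<ge> 1" by (auto simp: a_def b_def)
  have "b ^ 2 \<le> (2 * a) ^ 2" using ab by (simp add: power_mult_distrib)
  then have ba: "b \<le> 2 * a" by (rule power2_le_imp_le) (use ab in simp)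
  have le: "b * (a + b) \<le> 4 * a ^ 2"
  proof -
    have "a * b \<le> 2 * a ^ 2" using ba ab by (simp add: power2_eq_square)
    moreover have "b * b \<le> 2 * a ^ 2" using ab by (simp add: power2_eq_square[symmetric])
    ultimately show ?thesis by (simp add: algebra_simps)
  qed
  have "(b - a) * (a + b) = 1" using ab(3) by (simp add: algebra_simps power2_eq_square)
  then have "b - a = 1 / (a + b)" using ab by (simp add: field_simps)
  then have "1 / a - 1 / b = 1 / (a * b * (a + b))" using ab by (simp add: diff_frac_eq mult.commute)
  moreover have "a * b * (a + b) \<le> 4 * a ^ 3"
    using mult_left_mono[OF le, of a] ab by (simp add: power2_eq_square power3_eq_cube mult_ac)
  then have "4 / (4 * a ^ 3) \<le> 4 / (a * b * (a + b))" using ab by (intro divide_left_mono) auto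
  ultimately have "1 / a ^ 3 \<le> 4 * (1 / a - 1 / b)" by simp
  moreover have half: "real (Suc n) powr (- 1 / 2) = 1 / a" "real (Suc (Suc n)) powr (- 1 / 2) = 1 / b"
    by (simp_all add: a_def b_def powr_minus_divide powr_half_sqrt del: of_nat_Suc)
  moreover have "real (Suc n) powr (- 3 / 2) = 1 / a ^ 3"
  proof -
    have "real (Suc n) powr (- 1 / 2 + - 1 / 2 + - 1 / 2)
        = real (Suc n) powr (- 1 / 2) * real (Suc n) powr (- 1 / 2) * real (Suc n) powr (- 1 / 2)"
      by (simp only: powr_add)
    also have "\<dots> = 1 / a ^ 3" unfolding half by (simp add: power3_eq_cube)
    finally show ?thesis by simp
  qed
  ultimately show ?thesis by simp
qed

text \<open>Half a power of n absorbs the polylogarithm, so the increments are O(n^(-3/2)); by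
  \<open>powr_telescope\<close> the tails are O(n^(-1/2)).\<close>

lemma ex_limit_log_small:
  assumes "polylog g" "\<And>n. \<bar>f (Suc n) - f n\<bar> \<le> \<bar>g n\<bar> / real (Suc n) ^ 2"
  obtains c where "log_small (\<lambda>n. f n - c)"
proof -
  obtain C where C: "C \<ge> 0" "\<And>n. \<bar>g n\<bar> \<le> C * real (Suc n) powr (1 / 2)"
    using polylog_powr_bound[OF assms(1), of "1/2"] by auto
  define u where "u = (\<lambda>n. 4 * C * real (Suc n) powr (- 1 / 2))"
  have u0: "u \<longlonglongrightarrow> 0" unfolding u_def by real_asymp
  have step: "\<bar>f (Suc n) - f n\<bar> \<le> u n - u (Suc n)" for n
  proof -
    have "\<bar>f (Suc n) - f n\<bar> \<le> C * real (Suc n) powr (1 / 2) / real (Suc n) ^ 2"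
      by (rule order_trans[OF assms(2)], rule divide_right_mono[OF C(2)]) simp
    also have "\<dots> = C * real (Suc n) powr (- 3 / 2)"
    proof -
      have "real (Suc n) powr (1 / 2 - 2) = real (Suc n) powr (1 / 2) / real (Suc n) powr 2"
        by (rule powr_diff)
      then show ?thesis by (simp del: of_nat_Suc)
    qed
    also have "\<dots> \<le> C * (4 * (real (Suc n) powr (- 1 / 2) - real (Suc (Suc n)) powr (- 1 / 2)))"
      by (intro mult_left_mono powr_telescope C)
    finally show ?thesis by (simp add: u_def algebra_simps del: of_nat_Suc)
  qed
  have mn: "\<bar>f (n + k) - f n\<bar> \<le> u n - u (n + k)" for n k
  proof (induction k)
    case (Suc k)
    then show ?case using step[of "n + k"] by simp
  qed simp
  have upos: "u n \<ge> 0" for n using C by (simp add: u_def)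
  have "summable (\<lambda>n. u n - u (Suc n))" using telescope_summable'[OF u0] .
  then have "summable (\<lambda>n. f (Suc n) - f n)"
    by (rule summable_comparison_test') (use step in simp)
  then have "convergent (\<lambda>n. \<Sum>i<n. f (Suc i) - f i)" by (simp add: summable_iff_convergent)
  then have "convergent (\<lambda>n. (\<Sum>i<n. f (Suc i) - f i) + f 0)" by (intro convergent_add convergent_const)
  then obtain c where c: "f \<longlonglongrightarrow> c" by (auto simp: sum_lessThan_telescope convergent_def)
  have bd: "\<bar>f n - c\<bar> \<le> u n" for n
  proof -
    have "(\<lambda>k. \<bar>f (n + k) - f n\<bar>) \<longlonglongrightarrow> \<bar>c - f n\<bar>"
      using LIMSEQ_ignore_initial_segment[OF c, of n] by (intro tendsto_intros) (simp add: add.commute)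
    then have "\<bar>c - f n\<bar> \<le> u n"
      by (rule LIMSEQ_le_const2) (use mn upos in \<open>smt (verit)\<close>)
    then show ?thesis by simp
  qed
  have "log_small (\<lambda>n. f n - c)"
    by (rule log_small_powr[of "\<lambda>_. 4 * C" "1/2"])
      (use bd C in \<open>auto simp: polylog_const u_def\<close>)
  then show ?thesis by (rule that)
qed

text \<open>For a leading exponent at least 2 the increments are already of order log^r n / n^2. For
  the leading pair (1, -1) they become so after subtracting \<open>E\<close>, which is itself
  \<open>log_small\<close>.\<close>

lemma log_small_alt_sum_diff_alt_mzv:
  assumes s: "alt_index s" "leading_ones s = 0"
  shows "log_small (\<lambda>n. alt_sum s n - alt_mzv s)"
proof -
  have "\<exists>c. log_small (\<lambda>n. alt_sum s n - c)"
  proof (cases s)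
    case Nil
    then show ?thesis using log_small_0 by (intro exI[of _ 1]) simp
  next
    case (Cons x h)
    obtain a e where x: "x = (a, e)" by (cases x)
    from s have ae: "a \<ge> 1" "e \<in> {1, -1}" "a = 1 \<Longrightarrow> e = -1" and h: "alt_index h"
      by (auto simp: x Cons split: if_splits)
    have plh: "polylog (alt_sum h)" by (rule polylog_alt_sum[OF h])
    show ?thesis
    proof (cases "a = 1")
      case False
      then have a: "a \<ge> 2" using ae by simp
      have "\<bar>alt_sum s (Suc n) - alt_sum s n\<bar> \<le> \<bar>alt_sum h n\<bar> / real (Suc n) ^ 2" for n
      proof -
        have "real (Suc n) ^ 2 \<le> real (Suc n) ^ a" using a by (intro power_increasing) auto
        then have "\<bar>of_int e ^ Suc n / real (Suc n) ^ a\<bar> \<le> 1 / real (Suc n) ^ 2"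
          using ae by (auto simp: power_abs frac_le simp del: power_Suc of_nat_Suc)
        from mult_right_mono[OF this abs_ge_zero[of "alt_sum h n"]] show ?thesis
          by (simp add: Cons x nested_sum_Suc abs_mult del: power_Suc of_nat_Suc)
      qed
      from ex_limit_log_small[OF plh this] show ?thesis by blast
    next
      case True
      then have e: "e = -1" using ae by simp
      \<comment> \<open>E is half of the next term of the alternating series up to sign; subtracting it makes the increments \<open>O(log^r n / n^2)\<close>.\<close>
      define E where "E = (\<lambda>n. (-1) ^ n * alt_sum h n / (2 * real (Suc n)))"
      define D where "D = (\<lambda>n. real (Suc n) * (alt_sum h (Suc n) - alt_sum h n))"
      have plD: "polylog D" unfolding D_def by (rule polylog_alt_sum_increment[OF h])
      define g where "g = (\<lambda>n. \<bar>alt_sum h n\<bar> + \<bar>D n\<bar>)"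
      have plg: "polylog g" unfolding g_def
        by (intro polylog_add polylog_mono[OF plh] polylog_mono[OF plD]) auto
      have incr: "(alt_sum s (Suc n) - E (Suc n)) - (alt_sum s n - E n)
          = (-1) ^ Suc n * (alt_sum h n / (2 * real (Suc n) * real (n + 2))
                            - D n / (2 * real (Suc n) * real (n + 2)))" for n
      proof -
        have "alt_sum s (Suc n) - alt_sum s n = (-1) ^ Suc n * alt_sum h n / real (Suc n)"
          by (simp add: Cons x True e nested_sum_Suc del: of_nat_Suc)
        moreover have "alt_sum h (Suc n) = alt_sum h n + D n / real (Suc n)"
          by (simp add: D_def)
        \<comment> \<open>Here x stands for n + 1, the sign is (-1)^n, and s0, s1 and h0, h1 are
          successive values of \<open>alt_sum s\<close> and \<open>alt_sum h\<close>.\<close>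
        moreover have "(s1 + \<sigma> * h1 / (2 * (x + 1))) - (s0 - \<sigma> * h0 / (2 * x))
            = - \<sigma> * (h0 / (2 * x * (x + 1)) - d / (2 * x * (x + 1)))"
          if "s1 - s0 = - \<sigma> * h0 / x" "h1 = h0 + d / x" "x > 0" for s1 s0 \<sigma> h1 h0 d x :: real
        proof -
          have s1: "s1 = s0 - \<sigma> * h0 / x" using that(1) by simp
          show ?thesis using that(3) unfolding that(2) s1 by (simp add: divide_simps) (simp add: algebra_simps)
        qed
        from this[of "alt_sum s (Suc n)" "alt_sum s n" "(-1) ^ n" "alt_sum h n" "real (Suc n)"
            "alt_sum h (Suc n)" "D n"] calculation
        show ?thesis unfolding E_def by (simp add: add.commute)
      qed
      have "\<bar>(alt_sum s (Suc n) - E (Suc n)) - (alt_sum s n - E n)\<bar> \<le> \<bar>g n\<bar> / real (Suc n) ^ 2" for n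
      proof -
        have "\<bar>(alt_sum s (Suc n) - E (Suc n)) - (alt_sum s n - E n)\<bar>
          = \<bar>alt_sum h n - D n\<bar> / (2 * real (Suc n) * real (n + 2))"
          unfolding incr abs_mult by (simp add: power_abs abs_mult flip: diff_divide_distrib)
        also have "\<dots> \<le> \<bar>g n\<bar> / real (Suc n) ^ 2"
          by (rule frac_le) (auto simp: g_def power2_eq_square mult_mono)
        finally show ?thesis .
      qed
      from ex_limit_log_small[OF plg this] obtain c
        where c: "log_small (\<lambda>n. (alt_sum s n - E n) - c)" by blast
      have "log_small E"
      proof (rule log_small_powr[OF plh, of 1])
        fix n
        have "\<bar>alt_sum h n\<bar> / (2 * real (Suc n)) \<le> \<bar>alt_sum h n\<bar> / real (Suc n)"
          by (intro divide_left_mono) auto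
        then show "\<bar>E n\<bar> \<le> \<bar>alt_sum h n\<bar> * real (Suc n) powr (- 1)"
          by (simp add: E_def abs_mult power_abs powr_minus_divide del: of_nat_Suc)
      qed simp
      from log_small_add[OF c this] show ?thesis by (auto simp: algebra_simps)
    qed
  qed
  then obtain c where c: "log_small (\<lambda>n. alt_sum s n - c)" ..
  have "alt_sum s \<longlonglongrightarrow> c" using log_small_tendsto[OF c] by (simp add: LIM_zero_cancel)
  then have "alt_mzv s = c"
    unfolding alt_mzv_def by (intro limI) (simp add: alt_mzv_partial_eq[abs_def])
  with c show ?thesis by simp
qed

section \<open>Expansions in the harmonic number and the weight of limits\<close>

lemma CMZV2_add: "x \<in> CMZV2 w \<Longrightarrow> y \<in> CMZV2 w \<Longrightarrow> x + y \<in> CMZV2 w"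
  unfolding CMZV2_def by (rule rat_real.span_add)

lemma CMZV2_0: "0 \<in> CMZV2 w"
  unfolding CMZV2_def by (rule rat_real.span_zero)

lemma CMZV2_scale: "x \<in> CMZV2 w \<Longrightarrow> of_rat q * x \<in> CMZV2 w"
  unfolding CMZV2_def by (rule rat_real.span_scale)

text \<open>The higher coefficients are left free: a factor \<open>harm\<close> shifts them away
  from the constant one, and they vanish once the function has a limit.\<close>

definition has_expansion :: "nat \<Rightarrow> (nat \<Rightarrow> real) \<Rightarrow> bool" where
  "has_expansion w f \<longleftrightarrow> (\<exists>P. coeff P 0 \<in> CMZV2 w \<and> log_small (\<lambda>n. f n - poly P (harm n)))"

lemma has_expansion_lincomb:
  assumes "has_expansion w f" "has_expansion w g"
  shows "has_expansion w (\<lambda>n. of_rat q * f n + g n)"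
proof -
  obtain P Q where P: "coeff P 0 \<in> CMZV2 w" "log_small (\<lambda>n. f n - poly P (harm n))"
    and Q: "coeff Q 0 \<in> CMZV2 w" "log_small (\<lambda>n. g n - poly Q (harm n))"
    using assms unfolding has_expansion_def by blast
  show ?thesis unfolding has_expansion_def
  proof (intro exI conjI)
    show "coeff (smult (of_rat q) P + Q) 0 \<in> CMZV2 w"
      using P Q by (simp add: CMZV2_add CMZV2_scale)
    show "log_small (\<lambda>n. of_rat q * f n + g n - poly (smult (of_rat q) P + Q) (harm n))"
      using log_small_add[OF log_small_cmult[OF P(2), of "of_rat q"] Q(2)] by (simp add: algebra_simps)
  qed
qed

lemma has_expansion_0: "has_expansion w (\<lambda>_. 0)"
  unfolding has_expansion_def by (intro exI[of _ 0]) (simp add: CMZV2_0 log_small_0)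

text \<open>Regularisation by induction on the number of leading pairs (1, 1). Without any, the sum
  converges to its value; otherwise \<open>harm_times_alt_sum\<close> expresses it through sums with
  fewer such pairs and a product with \<open>harm\<close>.\<close>

lemma has_expansion_alt_sum:
  assumes "alt_index s"
  shows "has_expansion (alt_mzv_weight s) (alt_sum s)"
  using assms
proof (induction "leading_ones s" arbitrary: s rule: less_induct)
  case less
  show ?case
  proof (cases "leading_ones s")
    case 0
    have "alt_mzv s \<in> CMZV2 (alt_mzv_weight s)"
      unfolding CMZV2_def using less.prems 0
      by (intro rat_real.span_base) (auto simp: admissible_iff)
    then show ?thesis unfolding has_expansion_def
      using log_small_alt_sum_diff_alt_mzv[OF less.prems 0]
      by (intro exI[of _ "[:alt_mzv s:]"]) simp
  next
    case (Suc i)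
    then obtain s' where s: "s = (1, 1) # s'" by (cases s) (auto split: if_splits)
    from Suc less.prems have i: "leading_ones s' = i" and s': "alt_index s'" by (auto simp: s)
    define v where "v = (\<lambda>N. harm N * alt_sum s' N - of_nat (Suc i) * alt_sum s N)"
    have "alt_span (alt_mzv_weight s) i v"
      using harm_times_alt_sum[OF s'] unfolding v_def s i by simp
    then have "has_expansion (alt_mzv_weight s) v"
    proof (induction rule: alt_span.induct)
      case (step t f q)
      have "has_expansion (alt_mzv_weight s) (alt_sum t)"
        using less.hyps[of t] step.hyps Suc by simp
      then show ?case by (rule has_expansion_lincomb) (rule step.IH)
    qed (rule has_expansion_0)
    then obtain Q where Q: "coeff Q 0 \<in> CMZV2 (alt_mzv_weight s)" "log_small (\<lambda>n. v n - poly Q (harm n))"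
      unfolding has_expansion_def by blast
    \<comment> \<open>The index \<open>s'\<close> has weight one less, but its expansion enters only
      after multiplication by \<open>harm\<close>, hence with constant coefficient 0.\<close>
    obtain P where P: "log_small (\<lambda>n. alt_sum s' n - poly P (harm n))"
      using less.hyps[of s'] s' Suc i unfolding has_expansion_def by auto
    define c :: rat where "c = 1 / of_nat (Suc i)"
    have eq: "alt_sum s n = of_rat c * (harm n * alt_sum s' n + (- 1) * v n)" for n
      by (simp add: v_def c_def of_rat_divide del: of_nat_Suc)
    show ?thesis unfolding has_expansion_def
    proof (intro exI conjI)
      have "of_rat (-c) * coeff Q 0 \<in> CMZV2 (alt_mzv_weight s)"
        by (rule CMZV2_scale[OF Q(1)])
      then show "coeff (smult (of_rat c) (pCons 0 P - Q)) 0 \<in> CMZV2 (alt_mzv_weight s)"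
        by (simp add: of_rat_minus)
      show "log_small (\<lambda>n. alt_sum s n - poly (smult (of_rat c) (pCons 0 P - Q)) (harm n))"
        using log_small_cmult[OF log_small_add[OF log_small_harm[OF P]
            log_small_cmult[OF Q(2), of "-1"]], of "of_rat c"]
        unfolding eq by (simp add: algebra_simps)
    qed
  qed
qed

lemma has_expansion_alt_span: "alt_span w i f \<Longrightarrow> has_expansion w f"
proof (induction rule: alt_span.induct)
  case (step s f q)
  then show ?case using has_expansion_lincomb has_expansion_alt_sum by blast
qed (rule has_expansion_0)

text \<open>A nonconstant polynomial is unbounded along a sequence tending to infinity.\<close>

lemma poly_tendsto_at_top_imp_const:
  fixes P :: "real poly"
  assumes "filterlim x at_top sequentially" "(\<lambda>n. poly P (x n)) \<longlonglongrightarrow> S"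
  shows "S = coeff P 0"
proof (cases "degree P = 0")
  case True
  then obtain c where "P = [:c:]" by (rule degree_eq_zeroE)
  with assms(2) show ?thesis by (simp add: LIMSEQ_const_iff)
next
  case False
  have "filterlim (\<lambda>n. poly P (x n)) at_infinity sequentially"
    using filterlim_compose[OF filterlim_poly_at_infinity
        filterlim_at_top_imp_at_infinity[OF assms(1)], of P] False by simp
  with assms(2) show ?thesis using not_tendsto_and_filterlim_at_infinity trivial_limit_sequentially by blast
qed

text \<open>Arguments \<open>2 * N\<close> suffice, because the harmonic number still tends to
  infinity along them; the later Abel summations produce exactly such arguments.\<close>

lemma alt_span_limit_in_CMZV2:
  assumes "alt_span w i f" "(\<lambda>N. f (2 * N)) \<longlonglongrightarrow> S"
  shows "S \<in> CMZV2 w"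
proof -
  obtain P where P: "coeff P 0 \<in> CMZV2 w" "log_small (\<lambda>n. f n - poly P (harm n))"
    using has_expansion_alt_span[OF assms(1)] unfolding has_expansion_def by blast
  have "strict_mono (\<lambda>N::nat. 2 * N)" by (simp add: strict_mono_def)
  note sub = filterlim_compose[OF _ filterlim_subseq[OF this]]
  have "(\<lambda>N. f (2 * N) - (f (2 * N) - poly P (harm (2 * N)))) \<longlonglongrightarrow> S - 0"
    by (intro tendsto_diff assms(2) sub[OF log_small_tendsto[OF P(2)]])
  then have "S = coeff P 0"
    by (intro poly_tendsto_at_top_imp_const[OF sub[OF harm_at_top]]) simp
  with P show ?thesis by simp
qed

section \<open>Closure under strict and weak outer summation\<close>

text \<open>The order of divergence served the induction that regularises; from here on only the
  weight is tracked.\<close>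

definition trunc_alt :: "nat \<Rightarrow> (nat \<Rightarrow> real) \<Rightarrow> bool" where
  "trunc_alt w f \<longleftrightarrow> (\<exists>i. alt_span w i f)"

lemma trunc_alt_add: "trunc_alt w f \<Longrightarrow> trunc_alt w g \<Longrightarrow> trunc_alt w (\<lambda>N. f N + g N)"
  unfolding trunc_alt_def by (metis alt_span_add alt_span_mono max.cobounded1 max.cobounded2)

lemma trunc_alt_diff: "trunc_alt w f \<Longrightarrow> trunc_alt w g \<Longrightarrow> trunc_alt w (\<lambda>N. f N - g N)"
  unfolding trunc_alt_def by (metis alt_span_diff alt_span_mono max.cobounded1 max.cobounded2)

lemma trunc_alt_scale: "trunc_alt w f \<Longrightarrow> trunc_alt w (\<lambda>N. of_rat q * f N)"
  unfolding trunc_alt_def by (metis alt_span_scale)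

lemma trunc_alt_alt_sum: "alt_index s \<Longrightarrow> trunc_alt (alt_mzv_weight s) (alt_sum s)"
  unfolding trunc_alt_def using alt_span_alt_sum by blast

lemma trunc_alt_nested_sum:
  "trunc_alt w f \<Longrightarrow> a \<ge> 1 \<Longrightarrow> e \<in> {1, -1} \<Longrightarrow> trunc_alt (a + w) (nested_sum a e f)"
  unfolding trunc_alt_def using alt_span_nested_sum by blast

lemma polylog_trunc_alt: "trunc_alt w f \<Longrightarrow> polylog f"
  unfolding trunc_alt_def using polylog_alt_span by blast

definition star_sum :: "nat \<Rightarrow> int \<Rightarrow> (nat \<Rightarrow> real) \<Rightarrow> nat \<Rightarrow> real" where
  "star_sum a e f N = (\<Sum>n=1..N. of_int e ^ n / real n ^ a * f n)"

text \<open>The weak inequality splits into a strict one and an equality; at equality the exponents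
  add and the signs multiply.\<close>

lemma star_sum_alt_sum_Cons:
  "star_sum a e (alt_sum ((b, d) # s)) N = alt_sum ((a, e) # (b, d) # s) N + alt_sum ((a + b, e * d) # s) N"
proof (induction N)
  case (Suc N)
  have "star_sum a e (alt_sum ((b, d) # s)) (Suc N) = star_sum a e (alt_sum ((b, d) # s)) N
      + of_int e ^ Suc N / real (Suc N) ^ a * alt_sum ((b, d) # s) (Suc N)"
    by (simp add: star_sum_def)
  also have "alt_sum ((b, d) # s) (Suc N)
      = alt_sum ((b, d) # s) N + of_int d ^ Suc N / real (Suc N) ^ b * alt_sum s N"
    by (simp add: nested_sum_Suc)
  also have "of_int e ^ Suc N / real (Suc N) ^ a * (alt_sum ((b, d) # s) N + of_int d ^ Suc N / real (Suc N) ^ b * alt_sum s N)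
     = of_int e ^ Suc N / real (Suc N) ^ a * alt_sum ((b, d) # s) N
     + of_int (e * d) ^ Suc N / real (Suc N) ^ (a + b) * alt_sum s N"
    by (simp add: distrib_left power_add power_mult_distrib del: of_nat_Suc power_Suc)
  finally show ?case using Suc by (simp add: nested_sum_Suc)
qed (simp add: star_sum_def)

lemma star_sum_lincomb:
  "star_sum a e (\<lambda>N. c * f N + g N) N = c * star_sum a e f N + star_sum a e g N"
  by (simp add: star_sum_def sum.distrib sum_distrib_left algebra_simps add_divide_distrib)

lemma trunc_alt_star_sum:
  assumes "trunc_alt w f" "a \<ge> 1" "e \<in> {1, -1}"
  shows "trunc_alt (a + w) (star_sum a e f)"
proof -
  from assms(1) obtain i where "alt_span w i f" unfolding trunc_alt_def by blast
  then show ?thesis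
  proof (induction rule: alt_span.induct)
    case zero
    have "star_sum a e (\<lambda>_. 0) = (\<lambda>_. 0)" by (simp add: star_sum_def fun_eq_iff)
    then show ?case using alt_span.zero by (auto simp: trunc_alt_def)
  next
    case (step s f q)
    have "trunc_alt (a + w) (star_sum a e (alt_sum s))"
    proof (cases s)
      case Nil
      have "star_sum a e (alt_sum s) = alt_sum [(a, e)]"
        by (simp add: Nil fun_eq_iff star_sum_def nested_sum_def)
      then show ?thesis using trunc_alt_alt_sum[of "[(a, e)]"] assms step Nil by simp
    next
      case (Cons x s')
      obtain b d where x: "x = (b, d)" by (cases x)
      have "trunc_alt (alt_mzv_weight ((a, e) # s)) (alt_sum ((a, e) # s))"
        using assms step.hyps by (intro trunc_alt_alt_sum) auto
      moreover have "trunc_alt (alt_mzv_weight ((a + b, e * d) # s')) (alt_sum ((a + b, e * d) # s'))"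
        using assms step.hyps by (intro trunc_alt_alt_sum) (auto simp: Cons x)
      ultimately have "trunc_alt (a + w) (\<lambda>N. alt_sum ((a, e) # s) N + alt_sum ((a + b, e * d) # s') N)"
        using step.hyps by (intro trunc_alt_add) (simp_all add: Cons x add.assoc)
      then show ?thesis unfolding Cons x star_sum_alt_sum_Cons[abs_def] .
    qed
    from trunc_alt_add[OF trunc_alt_scale[OF this, of q] step.IH]
    show ?case unfolding star_sum_lincomb[abs_def] .
  qed
qed

section \<open>Growth of the factors of the series\<close>

definition central_ratio :: "nat \<Rightarrow> real" where
  "central_ratio n = 1 / 4 ^ n * real ((2 * n) choose n)"

lemma central_ratio_0: "central_ratio 0 = 1"
  by (simp add: central_ratio_def)

lemma central_ratio_Suc: "2 * real (Suc n) * central_ratio (Suc n) = (2 * real n + 1) * central_ratio n"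
proof -
  \<comment> \<open>The additional factor n + 1 lets two absorption identities for binomial
    coefficients apply in turn.\<close>
  have "Suc n * (Suc n * ((2 * Suc n) choose Suc n)) = Suc n * (2 * (2 * n + 1) * ((2 * n) choose n))"
  proof -
    have 1: "Suc n * ((2 * Suc n) choose Suc n) = (2 * Suc n) * (Suc (2 * n) choose n)"
      using Suc_times_binomial_eq[of "Suc (2 * n)" n] by (simp add: mult.commute)
    have 2: "Suc n * (Suc (2 * n) choose n) = Suc (2 * n) * ((2 * n) choose n)"
      using binomial_absorb_comp[of "Suc (2 * n)" n] by simp
    have "Suc n * (Suc n * ((2 * Suc n) choose Suc n)) = 2 * Suc n * (Suc n * (Suc (2 * n) choose n))"
      unfolding 1 by (simp only: mult_ac)
    then show ?thesis unfolding 2 by (simp only: mult_ac Suc_eq_plus1)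
  qed
  then have "Suc n * ((2 * Suc n) choose Suc n) = 2 * (2 * n + 1) * ((2 * n) choose n)"
    by (simp only: mult_cancel1) simp
  then have "real (Suc n * ((2 * Suc n) choose Suc n)) = real (2 * (2 * n + 1) * ((2 * n) choose n))"
    by (simp only:)
  then have "real (Suc n) * real ((2 * Suc n) choose Suc n) = 2 * (2 * real n + 1) * real ((2 * n) choose n)"
    by (simp only: of_nat_mult of_nat_add of_nat_numeral of_nat_1)
  moreover have "2 * x * (1 / 4 ^ Suc n * y) = z * (1 / 4 ^ n * b)" if "x * y = 2 * z * b" for x y z b :: real
    using that by simp
  ultimately show ?thesis unfolding central_ratio_def by blast
qed

lemma central_ratio_nonneg: "central_ratio n \<ge> 0"
  by (simp add: central_ratio_def)

lemma central_ratio_bound: "central_ratio n \<le> real (Suc n) powr (- 1 / 2)"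
proof -
  \<comment> \<open>As in Wallis's product, this quantity does not increase with n, because (2n +
    1)(2n + 3) <= (2n + 2)^2.\<close>
  have sq: "central_ratio n ^ 2 * (2 * real n + 1) \<le> 1"
  proof (induction n)
    case (Suc n)
    have eq: "central_ratio (Suc n) = (2 * real n + 1) / (2 * real (Suc n)) * central_ratio n"
      using central_ratio_Suc[of n] by (simp add: field_simps del: of_nat_Suc)
    have "central_ratio (Suc n) ^ 2 * (2 * real (Suc n) + 1)
       = (central_ratio n ^ 2 * (2 * real n + 1)) * ((2 * real n + 1) * (2 * real n + 3) / (2 * real n + 2) ^ 2)"
      unfolding eq by (simp add: power2_eq_square add.commute mult_ac)
    also have "\<dots> \<le> 1 * 1"
    proof (intro mult_mono)
      have "(2 * real n + 1) * (2 * real n + 3) \<le> (2 * real n + 2) ^ 2"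
        by (simp add: power2_eq_square algebra_simps)
      then show "(2 * real n + 1) * (2 * real n + 3) / (2 * real n + 2) ^ 2 \<le> 1"
        by (simp add: divide_le_eq)
    qed (use Suc in auto)
    finally show ?case by simp
  qed (simp add: central_ratio_0)
  have "central_ratio n ^ 2 * real (Suc n) \<le> central_ratio n ^ 2 * (2 * real n + 1)"
    by (intro mult_left_mono) auto
  with sq have "central_ratio n ^ 2 * real (Suc n) \<le> 1" by (rule order_trans[rotated])
  then have "central_ratio n ^ 2 \<le> (1 / sqrt (real (Suc n))) ^ 2"
    by (simp add: power_divide pos_le_divide_eq del: of_nat_Suc)
  then have "central_ratio n \<le> 1 / sqrt (real (Suc n))"
    by (rule power2_le_imp_le) simp
  then show ?thesis by (simp add: powr_minus_divide powr_half_sqrt del: of_nat_Suc)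
qed

lemma t_ones_nonneg: "t_ones n p \<ge> 0"
  by (induction p arbitrary: n) (auto simp: t_ones_0 t_ones_Suc intro!: sum_nonneg divide_nonneg_nonneg)

lemma zeta_star_nonneg: "zeta_star n k \<ge> 0"
  by (induction k arbitrary: n) (auto simp: zeta_star_Nil zeta_star_Cons intro!: sum_nonneg)

lemma zeta_star_mono: "m \<le> n \<Longrightarrow> zeta_star m k \<le> zeta_star n k"
  by (cases k) (auto simp: zeta_star_Nil zeta_star_Cons zeta_star_nonneg intro!: sum_mono2)

lemma polylog_t_ones: "polylog (\<lambda>n. t_ones n p)"
proof (induction p)
  case (Suc p)
  show ?case unfolding t_ones_Suc
    by (rule polylog_sum[OF polylog_pred[OF Suc]])
      (auto simp: t_ones_nonneg intro!: divide_left_mono)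
qed (simp add: t_ones_0 polylog_const)

lemma polylog_zeta_star: "\<forall>a\<in>set k. a \<ge> 1 \<Longrightarrow> polylog (\<lambda>n. zeta_star n k)"
proof (induction k)
  case (Cons a k)
  then have a: "a \<ge> 1" and IH: "polylog (\<lambda>n. zeta_star n k)" by auto
  show ?case unfolding zeta_star_Cons
  proof (rule polylog_sum[OF IH])
    fix n j :: nat assume j: "1 \<le> j"
    have "real j ^ 1 \<le> real j ^ a" using j a by (intro power_increasing) auto
    then show "\<bar>zeta_star j k / real j ^ a\<bar> \<le> \<bar>zeta_star j k\<bar> / real j"
      using j by (auto simp: zeta_star_nonneg intro!: divide_left_mono)
  qed
qed (simp add: zeta_star_Nil polylog_const)

section \<open>Reciprocal binomial coefficients\<close>

text \<open>The reciprocal of \<open>n + q\<close> choose \<open>n\<close>; the factorial form makes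
  the symmetry in \<open>n\<close> and \<open>q\<close> visible.\<close>

definition inv_binom :: "nat \<Rightarrow> nat \<Rightarrow> real" where
  "inv_binom n q = fact n * fact q / fact (n + q)"

lemma inv_binom_0: "inv_binom n 0 = 1"
  by (simp add: inv_binom_def)

lemma inv_binom_commute: "inv_binom n q = inv_binom q n"
  by (simp add: inv_binom_def add.commute mult.commute)

lemma inv_binom_nonneg: "inv_binom n q \<ge> 0"
  by (simp add: inv_binom_def)

lemma inv_binom_Suc: "real (n + Suc q) * inv_binom n (Suc q) = real (Suc q) * inv_binom n q"
proof -
  have "fact (n + Suc q) = real (n + Suc q) * fact (n + q)" by simp
  then show ?thesis unfolding inv_binom_def
    by (simp add: divide_simps del: of_nat_Suc of_nat_add)
qed

lemma inv_binom_Suc_le: "inv_binom n (Suc q) \<le> inv_binom n q"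
proof -
  have "real (n + Suc q) * inv_binom n (Suc q) \<le> real (n + Suc q) * inv_binom n q"
    unfolding inv_binom_Suc by (intro mult_right_mono) (auto simp: inv_binom_nonneg)
  then show ?thesis by (subst (asm) mult_le_cancel_left_pos) auto
qed

lemma inv_binom_le:
  assumes "q \<ge> 1"
  shows "inv_binom n q \<le> 1 / real (Suc n)"
  using assms
proof (induction q rule: dec_induct)
  case base
  have "real (Suc n) * inv_binom n 1 = 1" using inv_binom_Suc[of n 0] by (simp add: inv_binom_0)
  then show ?case by (simp add: field_simps)
next
  case (step q)
  then show ?case using inv_binom_Suc_le[of n q] by linarith
qed

lemma inv_binom_le_1: "inv_binom n q \<le> 1"
proof (cases "q = 0")
  case False
  then have "inv_binom n q \<le> 1 / real (Suc n)" by (intro inv_binom_le) simp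
  also have "\<dots> \<le> 1" by simp
  finally show ?thesis .
qed (simp add: inv_binom_0)

section \<open>The functions Phi and their recurrence in q\<close>

definition central_term :: "nat list \<Rightarrow> nat \<Rightarrow> nat \<Rightarrow> real" where
  "central_term k p n = central_ratio n * t_ones n p * zeta_star n k"

lemma central_term_nonneg: "central_term k p n \<ge> 0"
  by (simp add: central_term_def central_ratio_nonneg t_ones_nonneg zeta_star_nonneg)

text \<open>Half of the decay n^(-1/2) of the central ratio is given up to absorb the
  polylogarithmic factors.\<close>

lemma central_term_bound:
  assumes "\<forall>a\<in>set k. a \<ge> 1"
  obtains C where "C \<ge> 0" "\<And>n. central_term k p n \<le> C * real (Suc n) powr (- 1 / 4)"
proof -
  obtain C where C: "C \<ge> 0" "\<And>n. \<bar>t_ones n p * zeta_star n k\<bar> \<le> C * real (Suc n) powr (1 / 4)"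
    using polylog_powr_bound[OF polylog_mult[OF polylog_t_ones polylog_zeta_star[OF assms]], of "1/4"] by auto
  have "central_term k p n \<le> C * real (Suc n) powr (- 1 / 4)" for n
  proof -
    have "central_term k p n \<le> real (Suc n) powr (- 1 / 2) * (C * real (Suc n) powr (1 / 4))"
      unfolding central_term_def mult.assoc
      by (intro mult_mono central_ratio_bound order_trans[OF abs_ge_self C(2)])
        (auto simp: t_ones_nonneg zeta_star_nonneg)
    also have "\<dots> = C * real (Suc n) powr (- 1 / 2 + 1 / 4)" by (simp only: powr_add mult_ac)
    finally show ?thesis by simp
  qed
  with C that show ?thesis by blast
qed

definition Phi_term :: "nat \<Rightarrow> nat list \<Rightarrow> nat \<Rightarrow> nat \<Rightarrow> nat \<Rightarrow> real" where
  "Phi_term m k p q n = central_term k p n * inv_binom n q / real n ^ m"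

definition Phi :: "nat \<Rightarrow> nat list \<Rightarrow> nat \<Rightarrow> nat \<Rightarrow> real" where
  "Phi m k p q = (\<Sum>i. Phi_term m k p q (Suc i))"

lemma Phi_term_nonneg: "Phi_term m k p q n \<ge> 0"
  by (simp add: Phi_term_def central_term_nonneg inv_binom_nonneg)

text \<open>A further factor 1/n comes from n^m if m >= 1 and from \<open>inv_binom\<close> if q >=
  1; together with the decay of \<open>central_term\<close> this gives the exponent 5/4.\<close>

lemma summable_Phi:
  assumes "\<forall>a\<in>set k. a \<ge> 1" "m \<ge> 1 \<or> q \<ge> 1"
  shows "summable (\<lambda>i. Phi_term m k p q (Suc i))"
proof -
  obtain C where C: "C \<ge> 0" "\<And>n. central_term k p n \<le> C * real (Suc n) powr (- 1 / 4)"
    using central_term_bound[OF assms(1)] by blast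
  have bd: "Phi_term m k p q (Suc i) \<le> 2 * C * real (i + 2) powr (- 5 / 4)" for i
  proof -
    have "inv_binom (Suc i) q / real (Suc i) ^ m \<le> 2 / real (i + 2)"
      using assms(2)
    proof
      assume "m \<ge> 1"
      then have "real (Suc i) ^ 1 \<le> real (Suc i) ^ m" by (intro power_increasing) auto
      then have "inv_binom (Suc i) q / real (Suc i) ^ m \<le> 1 / real (Suc i)"
        by (intro frac_le inv_binom_le_1) auto
      also have "\<dots> \<le> 2 / real (i + 2)" by (simp add: field_simps)
      finally show ?thesis .
    next
      assume "q \<ge> 1"
      then have "inv_binom (Suc i) q / real (Suc i) ^ m \<le> (1 / real (Suc (Suc i))) / 1"
        by (intro frac_le inv_binom_le one_le_power) auto
      also have "\<dots> \<le> 2 / real (i + 2)" by (simp add: field_simps)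
      finally show ?thesis .
    qed
    then have "central_term k p (Suc i) * (inv_binom (Suc i) q / real (Suc i) ^ m)
        \<le> (C * real (Suc (Suc i)) powr (- 1 / 4)) * (2 / real (i + 2))"
      by (intro mult_mono C) (auto simp: inv_binom_nonneg C)
    also have "\<dots> = 2 * C * real (i + 2) powr (- 1 / 4 - 1)"
      unfolding powr_diff by simp
    finally show ?thesis by (simp add: Phi_term_def)
  qed
  have "summable (\<lambda>i. real i powr (- 5 / 4))" by (subst summable_real_powr_iff) simp
  then have "summable (\<lambda>i. 2 * C * real (i + 2) powr (- 5 / 4))"
    by (intro summable_mult summable_ignore_initial_segment)
  then show ?thesis
    by (rule summable_comparison_test') (use bd Phi_term_nonneg in auto)
qed

lemma Phi_nonneg: "\<forall>a\<in>set k. a \<ge> 1 \<Longrightarrow> m \<ge> 1 \<Longrightarrow> Phi m k p q \<ge> 0"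
  unfolding Phi_def by (intro suminf_nonneg summable_Phi) (auto simp: Phi_term_nonneg)

text \<open>By symmetry \<open>inv_binom n q\<close> is at most 1/(q + 1) for n >= 1. This decay
  removes the boundary terms in the Abel summations.\<close>

lemma Phi_le:
  assumes "\<forall>a\<in>set k. a \<ge> 1" "m \<ge> 1"
  shows "Phi m k p q \<le> Phi m k p 0 / real (Suc q)"
proof -
  have "Phi_term m k p q (Suc i) \<le> Phi_term m k p 0 (Suc i) / real (Suc q)" for i
  proof -
    have "inv_binom (Suc i) q \<le> 1 / real (Suc q)"
      using inv_binom_le[of "Suc i" q] by (simp add: inv_binom_commute)
    from mult_left_mono[OF this central_term_nonneg[of k p "Suc i"]]
    have "central_term k p (Suc i) * inv_binom (Suc i) q / real (Suc i) ^ m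
      \<le> central_term k p (Suc i) * (1 / real (Suc q)) / real (Suc i) ^ m"
      by (rule divide_right_mono) simp
    then show ?thesis by (simp add: Phi_term_def inv_binom_0 mult.commute)
  qed
  then have "Phi m k p q \<le> (\<Sum>i. Phi_term m k p 0 (Suc i) / real (Suc q))"
    unfolding Phi_def using assms
    by (intro suminf_le summable_divide summable_Phi) auto
  also have "\<dots> = Phi m k p 0 / real (Suc q)"
    unfolding Phi_def using assms by (intro suminf_divide summable_Phi) auto
  finally show ?thesis .
qed

text \<open>Termwise, \<open>inv_binom n q - inv_binom n (Suc q)\<close> is n/(q + 1) times
  \<open>inv_binom n (Suc q)\<close>, and the factor n lowers the exponent m.\<close>

lemma Phi_diff:
  assumes "\<forall>a\<in>set k. a \<ge> 1"
  shows "Phi (Suc m) k p q - Phi (Suc m) k p (Suc q) = Phi m k p (Suc q) / real (Suc q)"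
proof -
  have eq: "Phi_term (Suc m) k p q (Suc i) - Phi_term (Suc m) k p (Suc q) (Suc i)
      = Phi_term m k p (Suc q) (Suc i) / real (Suc q)" for i
  proof -
    have "real (Suc q) * (inv_binom (Suc i) q - inv_binom (Suc i) (Suc q)) = real (Suc i) * inv_binom (Suc i) (Suc q)"
      using inv_binom_Suc[of "Suc i" q] by (simp add: algebra_simps)
    then have "inv_binom (Suc i) q - inv_binom (Suc i) (Suc q) = real (Suc i) * inv_binom (Suc i) (Suc q) / real (Suc q)"
      by (simp add: field_simps del: of_nat_Suc)
    moreover have "Phi_term (Suc m) k p q (Suc i) - Phi_term (Suc m) k p (Suc q) (Suc i)
      = central_term k p (Suc i) * (inv_binom (Suc i) q - inv_binom (Suc i) (Suc q)) / real (Suc i) ^ Suc m"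
      by (simp add: Phi_term_def right_diff_distrib diff_divide_distrib)
    ultimately show ?thesis by (simp add: Phi_term_def del: of_nat_Suc)
  qed
  have "Phi (Suc m) k p q - Phi (Suc m) k p (Suc q)
      = (\<Sum>i. Phi_term (Suc m) k p q (Suc i) - Phi_term (Suc m) k p (Suc q) (Suc i))"
    unfolding Phi_def using assms by (intro suminf_diff summable_Phi) auto
  also have "\<dots> = (\<Sum>i. Phi_term m k p (Suc q) (Suc i) / real (Suc q))"
    unfolding eq ..
  also have "\<dots> = Phi m k p (Suc q) / real (Suc q)"
    unfolding Phi_def using assms by (intro suminf_divide summable_Phi) auto
  finally show ?thesis .
qed

section \<open>Telescoping in n and the values of Phi at m = 0\<close>

definition central_weight :: "nat \<Rightarrow> nat \<Rightarrow> real" where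
  "central_weight p n = central_ratio n * t_ones n p"

text \<open>Passing from n to n + 1 adds t_n(1_(p-1))/(2n + 1) to t_n(1_p), and the factor 2n + 1
  from the central ratio cancels this denominator.\<close>

lemma central_weight_Suc:
  "2 * real (Suc n) * central_weight p (Suc n)
     = (2 * real n + 1) * central_weight p n + (if p = 0 then 0 else central_weight (p - 1) n)"
proof (cases p)
  case 0
  then show ?thesis using central_ratio_Suc[of n] by (simp add: central_weight_def t_ones_0)
next
  case (Suc p')
  have "t_ones (Suc n) p = t_ones n p + t_ones n p' / (2 * real n + 1)"
    unfolding Suc t_ones_Suc by (simp add: add.commute)
  then have "2 * real (Suc n) * central_weight p (Suc n)
      = (2 * real n + 1) * central_ratio n * (t_ones n p + t_ones n p' / (2 * real n + 1))"
    unfolding central_weight_def using central_ratio_Suc[of n]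
    by (simp only: mult.assoc[symmetric])
  then show ?thesis using Suc by (simp add: central_weight_def distrib_left)
qed

lemma inv_binom_shift:
  "real (Suc n + Suc q) * inv_binom (Suc n) (Suc q) = real (Suc n) * inv_binom n (Suc q)"
  using inv_binom_Suc[of "Suc q" n] by (simp add: inv_binom_commute add.commute)

text \<open>Both \<open>v n\<close> and \<open>v (Suc n)\<close> are multiples of
  \<open>inv_binom n (Suc q)\<close>. The coefficients 2 (n + q + 1) and 2n + 1 of
  \<open>central_weight p n\<close> differ by 2q + 1, which is free of n.\<close>

lemma telescope_step:
  fixes p q n :: nat
  defines "v \<equiv> \<lambda>n. 2 * real (Suc q) * (central_weight p n * inv_binom n q)"
  shows "v n - v (Suc n) = ((2 * real q + 1) * central_weight p n
    - (if p = 0 then 0 else central_weight (p - 1) n)) * inv_binom n (Suc q)"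
proof -
  have v: "v n = 2 * real (n + Suc q) * inv_binom n (Suc q) * central_weight p n" for n
    using inv_binom_Suc[of n q] by (simp only: v_def mult.assoc) (simp only: mult_ac)
  have "v (Suc n) = 2 * (real (Suc n + Suc q) * inv_binom (Suc n) (Suc q)) * central_weight p (Suc n)"
    unfolding v by (simp only: mult_ac)
  also have "\<dots> = inv_binom n (Suc q) * (2 * real (Suc n) * central_weight p (Suc n))"
    unfolding inv_binom_shift by (simp only: mult_ac)
  finally have "v (Suc n) = inv_binom n (Suc q) * ((2 * real n + 1) * central_weight p n
     + (if p = 0 then 0 else central_weight (p - 1) n))"
    unfolding central_weight_Suc .
  then show ?thesis unfolding v by (simp add: algebra_simps)
qed

lemma summation_by_parts:
  fixes v z :: "nat \<Rightarrow> real"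
  shows "(\<Sum>n<N. (v (Suc n) - v (Suc (Suc n))) * z (Suc n))
    = (\<Sum>n<N. v (Suc n) * (z (Suc n) - z n)) + v 1 * z 0 - v (Suc N) * z N"
  by (induction N) (simp_all add: algebra_simps)

lemma central_term_null:
  assumes "\<forall>a\<in>set k. a \<ge> 1"
  shows "(\<lambda>n. central_term k p n) \<longlonglongrightarrow> 0"
proof -
  obtain C where C: "C \<ge> 0" "\<And>n. central_term k p n \<le> C * real (Suc n) powr (- 1 / 4)"
    using central_term_bound[OF assms] by blast
  have lim: "(\<lambda>n. C * real (Suc n) powr (- 1 / 4)) \<longlonglongrightarrow> 0" by real_asymp
  show ?thesis
    by (rule Lim_null_comparison[OF always_eventually lim]) (use C central_term_nonneg in auto)
qed

text \<open>\<open>telescope_step\<close> is multiplied by \<open>zeta_star n k\<close> and summed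
  by parts. R collects the increments of \<open>zeta_star\<close>; the boundary term at infinity
  vanishes, and the one at n = 1 survives only for empty \<open>k\<close>.\<close>

lemma Phi_0_recurrence_aux:
  assumes k: "\<forall>a\<in>set k. a \<ge> 1"
    and R: "(\<lambda>n. 2 * real (Suc q) * (central_weight p (Suc n) * inv_binom (Suc n) q)
              * (zeta_star (Suc n) k - zeta_star n k)) sums R"
  shows "(2 * real q + 1) * Phi 0 k p (Suc q) - (if p = 0 then 0 else Phi 0 k (p - 1) (Suc q))
    = R + 2 * central_weight p 1 * zeta_star 0 k"
proof -
  define v where "v = (\<lambda>n. 2 * real (Suc q) * (central_weight p n * inv_binom n q))"
  have S: "(\<lambda>i. Phi_term 0 k p' (Suc q) (Suc i)) sums Phi 0 k p' (Suc q)" for p'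
    unfolding Phi_def using k by (intro summable_sums summable_Phi) auto
  have "(\<lambda>i. (2 * real q + 1) * Phi_term 0 k p (Suc q) (Suc i)
          - (if p = 0 then 0 else Phi_term 0 k (p - 1) (Suc q) (Suc i)))
    sums ((2 * real q + 1) * Phi 0 k p (Suc q) - (if p = 0 then 0 else Phi 0 k (p - 1) (Suc q)))"
    by (cases "p = 0") (auto intro!: sums_diff sums_mult S)
  moreover have "(2 * real q + 1) * Phi_term 0 k p (Suc q) (Suc i)
          - (if p = 0 then 0 else Phi_term 0 k (p - 1) (Suc q) (Suc i))
      = (v (Suc i) - v (Suc (Suc i))) * zeta_star (Suc i) k" for i
    unfolding v_def telescope_step
    by (simp add: Phi_term_def central_term_def central_weight_def algebra_simps)
  ultimately have lhs: "(\<lambda>N. \<Sum>i<N. (v (Suc i) - v (Suc (Suc i))) * zeta_star (Suc i) k)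
    \<longlonglongrightarrow> (2 * real q + 1) * Phi 0 k p (Suc q) - (if p = 0 then 0 else Phi 0 k (p - 1) (Suc q))"
    by (simp add: sums_def)
  have vnull: "(\<lambda>N. v (Suc N) * zeta_star N k) \<longlonglongrightarrow> 0"
  proof (rule Lim_null_comparison[OF always_eventually])
    show "(\<lambda>N. 2 * real (Suc q) * central_term k p (Suc N)) \<longlonglongrightarrow> 0"
      by (intro tendsto_mult_right_zero LIMSEQ_Suc central_term_null k)
    have "v (Suc N) * zeta_star N k \<le> 2 * real (Suc q) * central_term k p (Suc N)" for N
    proof -
      have "central_weight p (Suc N) * inv_binom (Suc N) q \<le> central_weight p (Suc N) * 1"
        by (intro mult_left_mono inv_binom_le_1)
          (simp add: central_weight_def central_ratio_nonneg t_ones_nonneg)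
      then have "central_weight p (Suc N) * inv_binom (Suc N) q * zeta_star N k
          \<le> central_weight p (Suc N) * 1 * zeta_star (Suc N) k"
        by (rule mult_mono[OF _ zeta_star_mono])
          (auto simp: central_weight_def central_ratio_nonneg t_ones_nonneg zeta_star_nonneg)
      from mult_left_mono[OF this, of "2 * real (Suc q)"] show ?thesis
        by (simp add: v_def central_weight_def central_term_def mult.assoc)
    qed
    moreover have "v (Suc N) * zeta_star N k \<ge> 0" for N
      by (simp add: v_def central_weight_def central_ratio_nonneg t_ones_nonneg zeta_star_nonneg inv_binom_nonneg)
    ultimately show "\<forall>N. norm (v (Suc N) * zeta_star N k) \<le> 2 * real (Suc q) * central_term k p (Suc N)"
      by simp
  qed
  have "(\<lambda>N. (\<Sum>n<N. v (Suc n) * (zeta_star (Suc n) k - zeta_star n k)) + v 1 * zeta_star 0 k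
      - v (Suc N) * zeta_star N k) \<longlonglongrightarrow> R + v 1 * zeta_star 0 k - 0"
    using R by (intro tendsto_diff tendsto_add tendsto_const vnull) (simp add: sums_def v_def)
  then have "(\<lambda>N. \<Sum>i<N. (v (Suc i) - v (Suc (Suc i))) * zeta_star (Suc i) k)
      \<longlonglongrightarrow> R + v 1 * zeta_star 0 k"
    using summation_by_parts[of v "\<lambda>n. zeta_star n k"] by simp
  note eq = LIMSEQ_unique[OF lhs this]
  \<comment> \<open>This makes the boundary value \<open>v 1\<close> independent of q.\<close>
  have "real (Suc q) * inv_binom 1 q = 1"
    using inv_binom_Suc[of q 0] by (simp add: inv_binom_0 inv_binom_commute[of "Suc 0"])
  then have "v 1 = 2 * central_weight p 1"
    unfolding v_def by (metis mult.assoc mult.commute mult_1)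
  with eq show ?thesis by simp
qed

text \<open>The increment of \<open>zeta_star\<close> for \<open>a # k\<close> is the summand of its
  outermost sum, so R becomes a value of \<open>Phi a k p\<close> at q rather than q + 1, with a
  shorter index.\<close>

lemma Phi_0_Cons_recurrence:
  assumes "\<forall>a\<in>set (a # k). a \<ge> 1"
  shows "(2 * real q + 1) * Phi 0 (a # k) p (Suc q)
      - (if p = 0 then 0 else Phi 0 (a # k) (p - 1) (Suc q)) = 2 * real (Suc q) * Phi a k p q"
proof -
  have "(\<lambda>n. 2 * real (Suc q) * Phi_term a k p q (Suc n)) sums (2 * real (Suc q) * Phi a k p q)"
    unfolding Phi_def using assms by (intro sums_mult summable_sums summable_Phi) auto
  also have "(\<lambda>n. 2 * real (Suc q) * Phi_term a k p q (Suc n))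
     = (\<lambda>n. 2 * real (Suc q) * (central_weight p (Suc n) * inv_binom (Suc n) q)
              * (zeta_star (Suc n) (a # k) - zeta_star n (a # k)))"
    by (simp add: fun_eq_iff zeta_star_Cons Phi_term_def central_term_def central_weight_def)
  finally show ?thesis using Phi_0_recurrence_aux[OF assms] by (simp add: zeta_star_Cons)
qed

lemma Phi_0_Nil_recurrence:
  "(2 * real q + 1) * Phi 0 [] p (Suc q)
      - (if p = 0 then 0 else Phi 0 [] (p - 1) (Suc q)) = 2 * central_weight p 1"
  using Phi_0_recurrence_aux[of "[]" q p 0] by (simp add: zeta_star_Nil)

lemma t_ones_1: "t_ones 1 p = (if p \<le> 1 then 1 else 0)"
proof (cases p)
  case (Suc p')
  then show ?thesis by (cases p') (auto simp: t_ones_Suc t_ones_0)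
qed (simp add: t_ones_0)

text \<open>The subtracted 1 for p = 0 is the summand n = 0, which \<open>Phi\<close> omits and
  which is 0 for p > 0.\<close>

lemma Phi_0_Nil:
  "Phi 0 [] p (Suc q) = 2 * real (Suc q) / (2 * real q + 1) ^ Suc p - (if p = 0 then 1 else 0)"
proof (induction p)
  case 0
  have "(2 * real q + 1) * Phi 0 [] 0 (Suc q) = 1"
    using Phi_0_Nil_recurrence[of q 0] by (simp add: central_weight_def central_ratio_def t_ones_0)
  then show ?case by (simp add: field_simps)
next
  case (Suc p)
  \<comment> \<open>The boundary term is 1 exactly for p = 0, where it cancels the correction in the
    value for p.\<close>
  have "(2 * real q + 1) * Phi 0 [] (Suc p) (Suc q) = Phi 0 [] p (Suc q) + (if p = 0 then 1 else 0)"
    using Phi_0_Nil_recurrence[of q "Suc p"] t_ones_1[of "Suc p"]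
    by (simp add: central_weight_def central_ratio_def)
  also have "\<dots> = 2 * real (Suc q) / (2 * real q + 1) ^ Suc p" using Suc by simp
  finally have "Phi 0 [] (Suc p) (Suc q) = 2 * real (Suc q) / (2 * real q + 1) ^ Suc p / (2 * real q + 1)"
    by (subst nonzero_eq_divide_eq) (simp_all add: mult.commute)
  then show ?case by (simp add: mult.commute)
qed

text \<open>Unrolling the recurrence in p: every step down contributes another factor 1/(2q +
  1).\<close>

lemma Phi_0_Cons:
  assumes "\<forall>a\<in>set (a # k). a \<ge> 1"
  shows "Phi 0 (a # k) p (Suc q)
    = (\<Sum>j\<le>p. 2 * real (Suc q) / (2 * real q + 1) ^ Suc j * Phi a k (p - j) q)"
proof (induction p)
  case 0
  show ?case using Phi_0_Cons_recurrence[OF assms, of q 0] by (simp add: field_simps)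
next
  case (Suc p)
  have "(2 * real q + 1) * Phi 0 (a # k) (Suc p) (Suc q)
      = 2 * real (Suc q) * Phi a k (Suc p) q + Phi 0 (a # k) p (Suc q)"
    using Phi_0_Cons_recurrence[OF assms, of q "Suc p"] by simp
  then have "Phi 0 (a # k) (Suc p) (Suc q)
      = (2 * real (Suc q) * Phi a k (Suc p) q + Phi 0 (a # k) p (Suc q)) / (2 * real q + 1)"
    by (subst nonzero_eq_divide_eq) (simp_all add: mult.commute)
  also have "\<dots> = 2 * real (Suc q) / (2 * real q + 1) * Phi a k (Suc p) q + Phi 0 (a # k) p (Suc q) / (2 * real q + 1)"
    by (simp only: add_divide_distrib times_divide_eq_left)
  also have "Phi 0 (a # k) p (Suc q) / (2 * real q + 1)
      = (\<Sum>j\<le>p. 2 * real (Suc q) / (2 * real q + 1) ^ Suc (Suc j) * Phi a k (p - j) q)"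
    unfolding Suc sum_divide_distrib by (intro sum.cong) simp_all
  also have "2 * real (Suc q) / (2 * real q + 1) * Phi a k (Suc p) q
      + (\<Sum>j\<le>p. 2 * real (Suc q) / (2 * real q + 1) ^ Suc (Suc j) * Phi a k (p - j) q)
    = (\<Sum>j\<le>Suc p. 2 * real (Suc q) / (2 * real q + 1) ^ Suc j * Phi a k (Suc p - j) q)"
    by (simp only: sum.atMost_Suc_shift) simp
  finally show ?case .
qed

section \<open>Absorbing denominators and Abel summation\<close>

text \<open>The factor 1 + (-1)^n (resp. 1 - (-1)^n) selects the even (resp. odd) outer variables, with weight 2.\<close>

definition even_sum :: "(nat \<Rightarrow> real) \<Rightarrow> nat \<Rightarrow> real" where
  "even_sum f N = nested_sum 1 1 f N + nested_sum 1 (-1) f N"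

definition odd_sum :: "nat \<Rightarrow> (nat \<Rightarrow> real) \<Rightarrow> nat \<Rightarrow> real" where
  "odd_sum a f N = star_sum a 1 f N - star_sum a (-1) f N"

lemma trunc_alt_even_sum: "trunc_alt w f \<Longrightarrow> trunc_alt (Suc w) (even_sum f)"
  unfolding even_sum_def[abs_def]
  using trunc_alt_add[OF trunc_alt_nested_sum[of w f 1 1] trunc_alt_nested_sum[of w f 1 "-1"]] by simp

lemma trunc_alt_odd_sum: "trunc_alt w f \<Longrightarrow> a \<ge> 1 \<Longrightarrow> trunc_alt (a + w) (odd_sum a f)"
  unfolding odd_sum_def[abs_def]
  using trunc_alt_diff[OF trunc_alt_star_sum[of w f a 1] trunc_alt_star_sum[of w f a "-1"]] by simp

lemma even_sum_0: "even_sum f 0 = 0"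
  by (simp add: even_sum_def)

lemma odd_sum_0: "odd_sum a f 0 = 0"
  by (simp add: odd_sum_def star_sum_def)

lemma even_sum_odd_arg: "even_sum f (2 * i + 1) = even_sum f (2 * i)"
  by (simp add: even_sum_def nested_sum_Suc)

text \<open>Only the outer variable 2i + 2 contributes, with doubled weight 2/(2i + 2); as
  \<open>nested_sum\<close> is strict, \<open>f\<close> is taken one below, at 2i + 1.\<close>

lemma even_sum_step: "even_sum f (2 * Suc i) - even_sum f (2 * i) = f (2 * i + 1) / real (Suc i)"
proof -
  have "even_sum f (2 * Suc i) - even_sum f (2 * i + 1) = 2 * f (2 * i + 1) / (2 * real (Suc i))"
    by (simp add: even_sum_def nested_sum_Suc divide_simps) (simp add: algebra_simps)
  then show ?thesis unfolding even_sum_odd_arg by (simp del: of_nat_Suc)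
qed

text \<open>Only the outer variable 2i + 1 contributes. The weak sum takes \<open>f\<close> at 2i +
  1 too, so both constructions absorb denominators next to the same value of
  \<open>f\<close>.\<close>

lemma odd_sum_step: "odd_sum a f (2 * Suc i) - odd_sum a f (2 * i) = 2 * f (2 * i + 1) / (2 * real i + 1) ^ a"
  by (simp add: odd_sum_def star_sum_def add.commute)

lemma odd_sum_even_arg: "odd_sum a f (2 * Suc i) = odd_sum a f (2 * i + 1)"
  by (simp add: odd_sum_def star_sum_def)

text \<open>This version samples the second factor at i + 1, as \<open>Phi_diff\<close> requires;
  \<open>abel_summation_right\<close> samples it at i, as \<open>Phi_0_Cons\<close>
  requires.\<close>

lemma abel_summation_left:
  fixes A \<phi> :: "nat \<Rightarrow> real"
  assumes "A 0 = 0"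
  shows "(\<Sum>i<N. (A (Suc i) - A i) * \<phi> (Suc i)) = A N * \<phi> N + (\<Sum>i<N. A i * (\<phi> i - \<phi> (Suc i)))"
  using assms by (induction N) (simp_all add: algebra_simps)

lemma abel_summation_right:
  fixes A \<phi> :: "nat \<Rightarrow> real"
  assumes "A 0 = 0"
  shows "(\<Sum>i<N. (A (Suc i) - A i) * \<phi> i) = A N * \<phi> N + (\<Sum>i<N. A (Suc i) * (\<phi> i - \<phi> (Suc i)))"
  using assms by (induction N) (simp_all add: algebra_simps)

lemma polylog_times_Phi_null:
  assumes "polylog G" "\<forall>a\<in>set k. a \<ge> 1" "m \<ge> 1"
  shows "(\<lambda>N. G (2 * N) * Phi m k p N) \<longlonglongrightarrow> 0"
proof -
  have "strict_mono (\<lambda>N::nat. 2 * N)" by (simp add: strict_mono_def)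
  from filterlim_compose[OF polylog_powr_null[OF assms(1), of 1] filterlim_subseq[OF this]]
  have "(\<lambda>N. G (2 * N) * real (Suc (2 * N)) powr (- 1)) \<longlonglongrightarrow> 0" by simp
  then have lim: "(\<lambda>N. 2 * Phi m k p 0 * \<bar>G (2 * N) * real (Suc (2 * N)) powr (- 1)\<bar>) \<longlonglongrightarrow> 0"
    by (intro tendsto_mult_right_zero tendsto_rabs_zero)
  show ?thesis
  proof (rule Lim_null_comparison[OF always_eventually lim], rule allI)
    fix N
    have "Phi m k p N \<le> Phi m k p 0 / real (Suc N)" by (rule Phi_le[OF assms(2,3)])
    \<comment> \<open>The factor 2 compensates for replacing N + 1 by 2N + 1, the quantity in the
      bound for \<open>G\<close>.\<close>
    also have "\<dots> \<le> 2 * Phi m k p 0 / real (Suc (2 * N))"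
      using Phi_nonneg[OF assms(2,3), of p 0] by (simp add: field_simps)
    finally have "\<bar>G (2 * N)\<bar> * Phi m k p N \<le> \<bar>G (2 * N)\<bar> * (2 * Phi m k p 0 / real (Suc (2 * N)))"
      by (rule mult_left_mono) simp
    then show "norm (G (2 * N) * Phi m k p N) \<le> 2 * Phi m k p 0 * \<bar>G (2 * N) * real (Suc (2 * N)) powr (- 1)\<bar>"
      using Phi_nonneg[OF assms(2,3), of p N]
      by (simp add: abs_mult powr_minus_divide mult_ac del: of_nat_Suc)
  qed
qed

lemma trunc_alt_limit: "trunc_alt w f \<Longrightarrow> (\<lambda>N. f (2 * N)) \<longlonglongrightarrow> S \<Longrightarrow> S \<in> CMZV2 w"
  unfolding trunc_alt_def using alt_span_limit_in_CMZV2 by blast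

section \<open>Sums of differences of Phi twisted by truncated alternating sums\<close>

text \<open>For empty index and m = 1 the difference of \<open>Phi\<close> is explicit, so the
  partial sums are exactly values \<open>H (2 * N)\<close>. For p = 0 its two parts are only of
  order 1/i each, and summability rests on their cancellation to order 1/i^2.\<close>

lemma twisted_Phi_Nil:
  assumes F: "trunc_alt b F"
  shows "\<exists>S\<in>CMZV2 (b + 1 + p).
    (\<lambda>i. F (2 * i + 1) * (Phi 1 [] p i - Phi 1 [] p (Suc i))) sums S"
proof -
  define H where "H = (\<lambda>N. odd_sum (Suc p) F N - (if p = 0 then even_sum F N else 0))"
  define D where "D = (\<lambda>i. F (2 * i + 1) * (Phi 1 [] p i - Phi 1 [] p (Suc i)))"
  have H: "trunc_alt (b + 1 + p) H"
  proof (cases "p = 0")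
    case True
    then show ?thesis unfolding H_def
      using trunc_alt_diff[OF trunc_alt_odd_sum[OF F, of 1, simplified] trunc_alt_even_sum[OF F]]
      by (simp add: add.commute)
  next
    case False
    then show ?thesis unfolding H_def
      using trunc_alt_odd_sum[OF F, of "Suc p"] by (simp add: add.commute)
  qed
  have diff: "Phi 1 [] p i - Phi 1 [] p (Suc i)
      = 2 / (2 * real i + 1) ^ Suc p - (if p = 0 then 1 / real (Suc i) else 0)" for i
  proof -
    have "Phi 1 [] p i - Phi 1 [] p (Suc i) = Phi 0 [] p (Suc i) / real (Suc i)"
      using Phi_diff[of "[]" 0 p i] by simp
    also have "\<dots> = 2 / (2 * real i + 1) ^ Suc p - (if p = 0 then 1 / real (Suc i) else 0)"
      unfolding Phi_0_Nil by (simp add: diff_divide_distrib del: of_nat_Suc power_Suc)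
    finally show ?thesis .
  qed
  have DH: "D i = H (2 * Suc i) - H (2 * i)" for i
    using odd_sum_step[of "Suc p" F i] even_sum_step[of F i]
    unfolding D_def diff H_def
    by (cases "p = 0") (simp_all add: right_diff_distrib mult.commute del: of_nat_Suc power_Suc mult_Suc_right)
  have part: "(\<Sum>i<N. D i) = H (2 * N)" for N
    unfolding DH by (induction N) (simp_all add: H_def odd_sum_0 even_sum_0)
  obtain C where C: "C \<ge> 0" "\<And>n. \<bar>F n\<bar> \<le> C * real (Suc n) powr (1 / 2)"
    using polylog_powr_bound[OF polylog_trunc_alt[OF F], of "1/2"] by auto
  have bd: "norm (D i) \<le> 8 * C * real (2 * i + 2) powr (- 3 / 2)" for i
  proof -
    \<comment> \<open>The constant 8 is dictated by p > 0, where equality holds at i = 0.\<close>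
    have "\<bar>2 / (2 * real i + 1) ^ Suc p - (if p = 0 then 1 / real (Suc i) else 0)\<bar> \<le> 8 / real (2 * i + 2) ^ 2"
    proof (cases "p = 0")
      case True
      have "2 / (2 * x + 1) - 1 / (x + 1) = 8 / (8 * (2 * x + 1) * (x + 1))"
        and "8 / (8 * (2 * x + 1) * (x + 1)) \<le> 8 / (2 * x + 2) ^ 2" if "x \<ge> 0" for x :: real
        using that by (simp add: divide_simps, intro frac_le)
          (auto simp: power2_eq_square algebra_simps intro!: add_pos_nonneg)
      from this[of "real i"] True show ?thesis by (simp add: add.commute)
    next
      case False
      have "(2 * real i + 1) ^ 2 \<le> (2 * real i + 1) ^ Suc p"
        using False by (intro power_increasing) auto
      then have "2 / (2 * real i + 1) ^ Suc p \<le> 2 / (2 * real i + 1) ^ 2"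
        by (intro divide_left_mono) auto
      also have "\<dots> = 8 / (4 * real i + 2) ^ 2" by (simp add: divide_simps) (simp add: power2_eq_square algebra_simps)
      also have "\<dots> \<le> 8 / real (2 * i + 2) ^ 2" by (intro frac_le power_mono) auto
      finally show ?thesis using False by simp
    qed
    moreover have "\<bar>F (2 * i + 1)\<bar> \<le> C * real (2 * i + 2) powr (1 / 2)" using C(2)[of "2 * i + 1"] by simp
    ultimately have "norm (D i) \<le> (C * real (2 * i + 2) powr (1 / 2)) * (8 / real (2 * i + 2) ^ 2)"
      unfolding D_def diff real_norm_def abs_mult by (intro mult_mono) (auto simp: C)
    also have "\<dots> = 8 * C * real (2 * i + 2) powr (1 / 2 - 2)" unfolding powr_diff by simp
    finally show ?thesis by simp
  qed
  have "strict_mono (\<lambda>i::nat. 2 * i + 2)" by (simp add: strict_mono_def)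
  moreover have "summable (\<lambda>i. real i powr (- 3 / 2))" by (subst summable_real_powr_iff) simp
  ultimately have "summable (\<lambda>i. real (2 * i + 2) powr (- 3 / 2))"
    using summable_reindex[of "\<lambda>i. real i powr (- 3 / 2)" "\<lambda>i. 2 * i + 2"]
    by (simp add: o_def strict_mono_imp_inj_on)
  then have "summable (\<lambda>i. 8 * C * real (2 * i + 2) powr (- 3 / 2))" by (rule summable_mult)
  then have "summable D" by (rule summable_comparison_test') (use bd in blast)
  then obtain S where S: "D sums S" by (auto simp: summable_def)
  then have "(\<lambda>N. H (2 * N)) \<longlonglongrightarrow> S" by (simp add: sums_def part)
  with trunc_alt_limit[OF H] S show ?thesis unfolding D_def by blast
qed

text \<open>\<open>Phi_diff\<close> turns the difference into \<open>Phi m\<close> at i + 1 divided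
  by i + 1. \<open>even_sum\<close> absorbs this denominator, and Abel summation restores
  differences, so one unit of weight moves from m to F.\<close>

lemma twisted_Phi_Suc:
  assumes IH: "\<And>b F. trunc_alt b F \<Longrightarrow> \<exists>S\<in>CMZV2 (b + sum_list k + m + p).
      (\<lambda>i. F (2 * i + 1) * (Phi m k p i - Phi m k p (Suc i))) sums S"
    and F: "trunc_alt b F" and k: "\<forall>a\<in>set k. a \<ge> 1" and m: "m \<ge> 1"
  shows "\<exists>S\<in>CMZV2 (b + sum_list k + Suc m + p).
    (\<lambda>i. F (2 * i + 1) * (Phi (Suc m) k p i - Phi (Suc m) k p (Suc i))) sums S"
proof -
  define G where "G = even_sum F"
  have G: "trunc_alt (Suc b) G" unfolding G_def by (rule trunc_alt_even_sum[OF F])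
  obtain S where S: "S \<in> CMZV2 (Suc b + sum_list k + m + p)"
    and sums: "(\<lambda>i. G (2 * i + 1) * (Phi m k p i - Phi m k p (Suc i))) sums S"
    using IH[OF G] by blast
  have eq: "F (2 * i + 1) * (Phi (Suc m) k p i - Phi (Suc m) k p (Suc i))
      = (G (2 * Suc i) - G (2 * i)) * Phi m k p (Suc i)" for i
    unfolding Phi_diff[OF k] G_def even_sum_step by simp
  \<comment> \<open>\<open>G\<close> does not change from 2i to 2i + 1, which matches the argument
    in the induction hypothesis.\<close>
  have "(\<lambda>N. G (2 * N) * Phi m k p N + (\<Sum>i<N. G (2 * i) * (Phi m k p i - Phi m k p (Suc i)))) \<longlonglongrightarrow> 0 + S"
    using sums polylog_times_Phi_null[OF polylog_trunc_alt[OF G] k m]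
    by (intro tendsto_add) (simp_all add: sums_def G_def even_sum_odd_arg[simplified])
  then have "(\<lambda>i. F (2 * i + 1) * (Phi (Suc m) k p i - Phi (Suc m) k p (Suc i))) sums S"
    unfolding sums_def eq
    using abel_summation_left[of "\<lambda>i. G (2 * i)" "Phi m k p"] by (simp add: G_def even_sum_0)
  with S show ?thesis by auto
qed

text \<open>At m = 1 the difference is \<open>Phi 0 (a # k)\<close> divided by i + 1, and this
  denominator cancels the numerators in \<open>Phi_0_Cons\<close>. \<open>odd_sum\<close> absorbs
  the powers of 2i + 1: weight j + 1 passes to F while p drops to p - j, so the hypothesis must
  cover all p.\<close>

lemma twisted_Phi_Cons:
  assumes IH: "\<And>b F p. trunc_alt b F \<Longrightarrow> \<exists>S\<in>CMZV2 (b + sum_list k + a + p).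
      (\<lambda>i. F (2 * i + 1) * (Phi a k p i - Phi a k p (Suc i))) sums S"
    and F: "trunc_alt b F" and k: "\<forall>a\<in>set (a # k). a \<ge> 1"
  shows "\<exists>S\<in>CMZV2 (b + sum_list (a # k) + 1 + p).
    (\<lambda>i. F (2 * i + 1) * (Phi 1 (a # k) p i - Phi 1 (a # k) p (Suc i))) sums S"
proof -
  have "\<exists>S\<in>CMZV2 (b + sum_list (a # k) + 1 + p).
      (\<lambda>i. 2 * F (2 * i + 1) / (2 * real i + 1) ^ Suc j * Phi a k (p - j) i) sums S"
    if j: "j \<le> p" for j
  proof -
    define G where "G = odd_sum (Suc j) F"
    have G: "trunc_alt (Suc j + b) G" unfolding G_def by (rule trunc_alt_odd_sum[OF F]) simp
    obtain S where S: "S \<in> CMZV2 (Suc j + b + sum_list k + a + (p - j))"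
      and sums: "(\<lambda>i. G (2 * i + 1) * (Phi a k (p - j) i - Phi a k (p - j) (Suc i))) sums S"
      using IH[OF G] by blast
    have eq: "2 * F (2 * i + 1) / (2 * real i + 1) ^ Suc j * Phi a k (p - j) i
        = (G (2 * Suc i) - G (2 * i)) * Phi a k (p - j) i" for i
      unfolding G_def odd_sum_step ..
    have "(\<lambda>N. G (2 * N) * Phi a k (p - j) N
        + (\<Sum>i<N. G (2 * Suc i) * (Phi a k (p - j) i - Phi a k (p - j) (Suc i)))) \<longlonglongrightarrow> 0 + S"
    proof (intro tendsto_add)
      show "(\<lambda>N. G (2 * N) * Phi a k (p - j) N) \<longlonglongrightarrow> 0"
        using k by (intro polylog_times_Phi_null[OF polylog_trunc_alt[OF G]]) auto
      show "(\<lambda>N. \<Sum>i<N. G (2 * Suc i) * (Phi a k (p - j) i - Phi a k (p - j) (Suc i))) \<longlonglongrightarrow> S"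
        using sums unfolding sums_def G_def odd_sum_even_arg .
    qed
    then have "(\<lambda>i. 2 * F (2 * i + 1) / (2 * real i + 1) ^ Suc j * Phi a k (p - j) i) sums S"
      unfolding sums_def eq
      using abel_summation_right[of "\<lambda>i. G (2 * i)" "Phi a k (p - j)"] by (simp add: G_def odd_sum_0)
    moreover have "Suc j + b + sum_list k + a + (p - j) = b + sum_list (a # k) + 1 + p"
      using j by simp
    with S have "S \<in> CMZV2 (b + sum_list (a # k) + 1 + p)" by (simp only:)
    ultimately show ?thesis by (rule bexI)
  qed
  then have "\<forall>j. \<exists>S. j \<le> p \<longrightarrow> S \<in> CMZV2 (b + sum_list (a # k) + 1 + p) \<and>
      (\<lambda>i. 2 * F (2 * i + 1) / (2 * real i + 1) ^ Suc j * Phi a k (p - j) i) sums S"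
    by blast
  from choice[OF this] obtain S where S: "\<And>j. j \<le> p \<Longrightarrow> S j \<in> CMZV2 (b + sum_list (a # k) + 1 + p)"
    "\<And>j. j \<le> p \<Longrightarrow> (\<lambda>i. 2 * F (2 * i + 1) / (2 * real i + 1) ^ Suc j * Phi a k (p - j) i) sums S j"
    by blast
  have "(\<lambda>i. \<Sum>j\<le>p. 2 * F (2 * i + 1) / (2 * real i + 1) ^ Suc j * Phi a k (p - j) i) sums (\<Sum>j\<le>p. S j)"
    using S(2) by (intro sums_sum) auto
  moreover have "(\<Sum>j\<le>p. 2 * F (2 * i + 1) / (2 * real i + 1) ^ Suc j * Phi a k (p - j) i)
      = F (2 * i + 1) * (Phi 1 (a # k) p i - Phi 1 (a # k) p (Suc i))" for i
  proof -
    have "Phi 1 (a # k) p i - Phi 1 (a # k) p (Suc i) = Phi 0 (a # k) p (Suc i) / real (Suc i)"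
      using Phi_diff[OF k, of 0 p i] by simp
    also have "\<dots> = (\<Sum>j\<le>p. 2 / (2 * real i + 1) ^ Suc j * Phi a k (p - j) i)"
      unfolding Phi_0_Cons[OF k] sum_divide_distrib
      by (intro sum.cong) (simp_all del: of_nat_Suc power_Suc)
    finally show ?thesis by (simp add: sum_distrib_left mult_ac)
  qed
  moreover have "(\<Sum>j\<le>p. S j) \<in> CMZV2 (b + sum_list (a # k) + 1 + p)"
    unfolding CMZV2_def by (rule rat_real.span_sum) (use S(1) in \<open>simp add: CMZV2_def\<close>)
  ultimately show ?thesis by (intro bexI[of _ "\<Sum>j\<le>p. S j"]) (simp_all only:)
qed

text \<open>Outer induction on \<open>k\<close>, inner induction on \<open>m\<close>. The case m = 1
  of \<open>a # k\<close> falls back on the shorter index \<open>k\<close> with exponent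
  \<open>a\<close>; F stays arbitrary because each reduction enlarges it.\<close>

lemma twisted_Phi:
  assumes "trunc_alt b F" "\<forall>a\<in>set k. a \<ge> 1" "m \<ge> 1"
  shows "\<exists>S\<in>CMZV2 (b + sum_list k + m + p).
    (\<lambda>i. F (2 * i + 1) * (Phi m k p i - Phi m k p (Suc i))) sums S"
  using assms
proof (induction k arbitrary: m p b F)
  case Nil
  from Nil.prems(3,1) show ?case
  proof (induction m arbitrary: b F rule: dec_induct)
    case base
    from twisted_Phi_Nil[OF base] show ?case by simp
  next
    case (step m)
    from step.hyps step.prems show ?case
      by (intro twisted_Phi_Suc[OF step.IH]) simp_all
  qed
next
  case (Cons a k)
  have k: "\<forall>a\<in>set k. a \<ge> 1" and a: "a \<ge> 1" using Cons.prems(2) by auto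
  from Cons.prems(3,1) show ?case
  proof (induction m arbitrary: b F rule: dec_induct)
    case base
    show ?case by (rule twisted_Phi_Cons[OF Cons.IH[OF _ k a] base Cons.prems(2)])
  next
    case (step m)
    show ?case by (rule twisted_Phi_Suc[OF step.IH step.prems Cons.prems(2) step.hyps(1)])
  qed
qed

theorem theorem9p5:
  fixes p m :: nat and k :: "nat list"
  assumes "k \<noteq> []" and "\<forall>a\<in>set k. a \<ge> 1" and "m \<ge> 1"
  shows "\<exists>S\<in>CMZV2 (sum_list k + m + p).
    (\<lambda>i. let n = Suc i in
       1 / 4 ^ n * real ((2 * n) choose n) * (zeta_star n k * t_ones n p / real n ^ m)) sums S"
proof -
  \<comment> \<open>The constant 1 is the truncated sum of the empty index, of weight 0; with it the
    twisted sum telescopes.\<close>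
  have "trunc_alt 0 (\<lambda>_. 1)" using trunc_alt_alt_sum[of "[]"] by simp
  from twisted_Phi[OF this assms(2,3), of p] obtain S where S: "S \<in> CMZV2 (sum_list k + m + p)"
    and sums: "(\<lambda>i. Phi m k p i - Phi m k p (Suc i)) sums S"
    by auto
  have "(\<lambda>N. 1 * Phi m k p N) \<longlonglongrightarrow> 0"
    using polylog_times_Phi_null[OF polylog_const assms(2,3)] .
  then have "(\<lambda>i. Phi m k p i - Phi m k p (Suc i)) sums (Phi m k p 0 - 0)"
    by (intro telescope_sums') simp
  from sums_unique2[OF sums this] have "S = Phi m k p 0" by simp
  moreover have "(\<lambda>i. Phi_term m k p 0 (Suc i)) sums Phi m k p 0"
    unfolding Phi_def using assms by (intro summable_sums summable_Phi) auto
  ultimately have "(\<lambda>i. Phi_term m k p 0 (Suc i)) sums S" by simp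
  then have "(\<lambda>i. let n = Suc i in
       1 / 4 ^ n * real ((2 * n) choose n) * (zeta_star n k * t_ones n p / real n ^ m)) sums S"
    by (simp add: Phi_term_def central_term_def central_ratio_def inv_binom_0 Let_def mult_ac)
  with S show ?thesis by blast
qed

end
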